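(* Let $Z$ be a JB*-triple of finite rank with open unit ball $B$. Then the set $\Gamma$ of extreme points of $\overline{B}$ is the smallest closed subset $\Lambda$ of $\overline{B}$ such that $$\sup\{|f(z)| : z\in\overline{B}\} = \sup\{|f(z)| : z\in\Lambda\}$$ for all $f:B\to\mathbb{C}$ holomorphic on $B$ with continuous extension to $\partial B$. (That is: $\Gamma$ is closed and has this property, and every closed subset $\Lambda\subseteq\overline{B}$ with this property contains $\Gamma$.)
   Context: A JB*-triple is a complex Banach space $Z$ with a real trilinear map $\{\cdot,\cdot,\cdot\}:Z\times Z\times Z\to Z$ such that: (i) $\{x,y,z\}$ is complex linear and symmetric in the outer variables $x,z$ and complex anti-linear in $y$; (ii) for every $x\in Z$ the map $x\square x: z\mapsto\{x,x,z\}$ is a Hermitian operator with spectrum contained in $[0,\infty)$ and $\|x\square x\|=\|x\|^2$; (iii) $\{a,b,\{x,y,z\}\}=\{\{a,b,x\},y,z\}-\{x,\{b,a,y\},z\}+\{x,y,\{a,b,z\}\}$ for all $a,b,x,y,z\in Z$. $B$ is the open unit ball of $Z$, $\overline B$ its norm closure, $\partial B$ its boundary. $Z$ has finite rank $r$ if every $z\in Z$ lies in a subtriple of complex dimension $\le r$, and $r$ is minimal with this property. The extended function on $\overline B$ is again denoted $f$. Suprema are taken in $[0,\infty]$ (they may be infinite). In any JB*-triple, the extreme points of $\overline B$ are exactly the maximal tripotents, i.e. the elements $e$ with $\{e,e,e\}=e$ for which $z\mapsto\{e,e,z\}$ has kernel $\{0\}$. *)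

theory Defs
  imports "HOL-Analysis.Analysis"
begin

class complex_banach = banach +
  fixes scaleC :: "complex \<Rightarrow> 'a \<Rightarrow> 'a"  (infixr "*\<^sub>C" 75)
  assumes scaleC_add_right: "c *\<^sub>C (x + y) = c *\<^sub>C x + c *\<^sub>C y"
    and scaleC_add_left: "(c + d) *\<^sub>C x = c *\<^sub>C x + d *\<^sub>C x"
    and scaleC_scaleC: "c *\<^sub>C d *\<^sub>C x = (c * d) *\<^sub>C x"
    and scaleC_one: "1 *\<^sub>C x = x"
    and scaleR_scaleC: "r *\<^sub>R x = complex_of_real r *\<^sub>C x"
    and norm_scaleC: "norm (c *\<^sub>C x) = cmod c * norm x"

global_interpretation complex_vector: vector_space "scaleC :: complex \<Rightarrow> 'a \<Rightarrow> 'a::complex_banach"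
  defines cspan = complex_vector.span
    and csubspace = complex_vector.subspace
    and cdependent = complex_vector.dependent
  by standard (simp_all add: scaleC_add_right scaleC_add_left scaleC_scaleC scaleC_one)

abbreviation clinear :: "('a::complex_banach \<Rightarrow> 'b::complex_banach) \<Rightarrow> bool"
  where "clinear \<equiv> Vector_Spaces.linear scaleC scaleC"

definition bounded_clinear :: "('a::complex_banach \<Rightarrow> 'b::complex_banach) \<Rightarrow> bool"
  where "bounded_clinear T \<longleftrightarrow> clinear T \<and> bounded_linear T"

definition op_spectrum :: "('a::complex_banach \<Rightarrow> 'a) \<Rightarrow> complex set"
  where "op_spectrum T =
    {l. \<not> (\<exists>S. bounded_clinear S \<and> (\<forall>x. S (l *\<^sub>C x - T x) = x) \<and> (\<forall>x. l *\<^sub>C S x - T (S x) = x))}"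

definition op_exp :: "('a::complex_banach \<Rightarrow> 'a) \<Rightarrow> 'a \<Rightarrow> 'a"
  where "op_exp T x = (\<Sum>n. (T ^^ n) x /\<^sub>R fact n)"

text \<open>An operator is Hermitian when \<open>exp (i t T)\<close> is an isometry for every real \<open>t\<close>.\<close>
definition hermitian_op :: "('a::complex_banach \<Rightarrow> 'a) \<Rightarrow> bool"
  where "hermitian_op T \<longleftrightarrow> bounded_clinear T \<and>
    (\<forall>(t::real) x. norm (op_exp (\<lambda>y. (\<i> * complex_of_real t) *\<^sub>C T y) x) = norm x)"

locale jb_star_triple =
  fixes triple :: "'a::complex_banach \<Rightarrow> 'a \<Rightarrow> 'a \<Rightarrow> 'a"
  assumes triple_clinear_left: "clinear (\<lambda>x. triple x y z)"
    and triple_commute: "triple x y z = triple z y x"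
    and triple_add_middle: "triple x (y + y') z = triple x y z + triple x y' z"
    and triple_scaleC_middle: "triple x (c *\<^sub>C y) z = cnj c *\<^sub>C triple x y z"
    and hermitian_box: "hermitian_op (triple x x)"
    and spectrum_box: "op_spectrum (triple x x) \<subseteq> complex_of_real ` {0..}"
    and onorm_box: "onorm (triple x x) = (norm x)\<^sup>2"
    and jordan_identity:
      "triple a b (triple x y z) =
        triple (triple a b x) y z - triple x (triple b a y) z + triple x y (triple a b z)"

definition subtriple :: "('a::complex_banach \<Rightarrow> 'a \<Rightarrow> 'a \<Rightarrow> 'a) \<Rightarrow> 'a set \<Rightarrow> bool"
  where "subtriple triple U \<longleftrightarrow> csubspace U \<and> (\<forall>x\<in>U. \<forall>y\<in>U. \<forall>z\<in>U. triple x y z \<in> U)"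

text \<open>The dimension is expressed through a finite basis because the library function \<open>dim\<close>
  is \<open>0\<close> on infinite-dimensional spaces.\<close>
definition cdim_le :: "'a::complex_banach set \<Rightarrow> nat \<Rightarrow> bool"
  where "cdim_le U n \<longleftrightarrow> (\<exists>S. finite S \<and> card S \<le> n \<and> \<not> cdependent S \<and> cspan S = U)"

definition rank_le :: "('a::complex_banach \<Rightarrow> 'a \<Rightarrow> 'a \<Rightarrow> 'a) \<Rightarrow> nat \<Rightarrow> bool"
  where "rank_le triple n \<longleftrightarrow> (\<forall>z. \<exists>U. subtriple triple U \<and> cdim_le U n \<and> z \<in> U)"

definition has_rank :: "('a::complex_banach \<Rightarrow> 'a \<Rightarrow> 'a \<Rightarrow> 'a) \<Rightarrow> nat \<Rightarrow> bool"
  where "has_rank triple r \<longleftrightarrow> rank_le triple r \<and> (\<forall>n<r. \<not> rank_le triple n)"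

text \<open>Frechet differentiability with complex-linear derivative; meant for open \<open>S\<close>.\<close>
definition cfrechet_holomorphic_on :: "('a::complex_banach \<Rightarrow> complex) \<Rightarrow> 'a set \<Rightarrow> bool"
  where "cfrechet_holomorphic_on f S \<longleftrightarrow>
    (\<forall>x\<in>S. \<exists>D. (f has_derivative D) (at x) \<and> Vector_Spaces.linear scaleC (*) D)"

text \<open>A function on the open unit ball together with its continuous extension is represented
  by the extended function; values outside the closed ball play no role.\<close>
definition ball_algebra :: "('a::complex_banach \<Rightarrow> complex) set"
  where "ball_algebra =
    {f. cfrechet_holomorphic_on f (ball 0 1) \<and> continuous_on (closure (ball 0 1)) f}"

text \<open>Suprema are taken in \<open>ennreal\<close>, i.e. in \<open>[0,\<infinity>]\<close>.\<close>
definition sup_determining :: "'a::complex_banach set \<Rightarrow> bool"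
  where "sup_determining L \<longleftrightarrow>
    (\<forall>f\<in>ball_algebra.
      (SUP z\<in>closure (ball 0 1). ennreal (cmod (f z))) = (SUP z\<in>L. ennreal (cmod (f z))))"

end

theory Submission
  imports Defs "HOL-Complex_Analysis.Conformal_Mappings" "HOL-Computational_Algebra.Fundamental_Theorem_Algebra"
begin

text \<open>
  Write \<open>a \<box> b = D(a,b)\<close> for the operator \<open>z \<mapsto> {a,b,z}\<close>, and \<open>Z\<^sub>k(e)\<close> for the \<open>k\<close>-eigenspace of \<open>e \<box> e\<close>.

  The set of extreme points turns out to be the set of maximal tripotents, and three facts about
  these give the theorem.

  \<^emph>\<open>Closedness.\<close>  Maximality of a tripotent \<open>e\<close> means that \<open>e \<box> e\<close> has eigenvalues \<open>1/2\<close> and \<open>1\<close>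
  only, that is, \<open>(2 D - 1)(D - 1) = 0\<close> for \<open>D = e \<box> e\<close>.  This is a closed condition, because
  \<open>e \<mapsto> e \<box> e\<close> is continuous (\<open>closed_maximal_tripotents\<close>).

  \<^emph>\<open>Maximal tripotents determine suprema.\<close>  In finite rank every \<open>z\<close> is a finite combination
  \<open>\<Sum> l\<^sub>e e\<close> of orthogonal tripotents with \<open>0 < l\<^sub>e \<le> \<parallel>z\<parallel>\<close> (\<open>spectral_decomposition\<close>), and the
  system can be enlarged, with coefficients \<open>0\<close>, until its sum is maximal.  If \<open>\<parallel>z\<parallel> < 1\<close>, then
  \<open>\<zeta> \<mapsto> \<Sum> (\<zeta> + l\<^sub>e)/(1 + l\<^sub>e \<zeta>) e\<close> is a holomorphic disc in the ball through \<open>z\<close> whose boundary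
  consists of maximal tripotents, and the maximum principle in one variable applies
  (\<open>maximal_tripotent_dominates\<close>).

  \<^emph>\<open>Maximal tripotents are strongly exposed.\<close>  Split a maximal \<open>e\<close> into primitive tripotents
  \<open>e\<^sub>1, \<dots>, e\<^sub>n\<close>, for which \<open>Z\<^sub>1(e\<^sub>j) = \<complex> e\<^sub>j\<close>, and let \<open>\<phi>\<close> be the sum of the coordinate functionals
  of the projections onto \<open>Z\<^sub>1(e\<^sub>j)\<close>.  On the closed unit ball \<open>Re \<phi> \<le> n = \<phi> e\<close>, and \<open>\<parallel>z - e\<parallel>\<close> is
  bounded by a multiple of \<open>sqrt (n - Re (\<phi> z))\<close> (\<open>maximal_tripotent_strongly_exposed\<close>).  Hence \<open>e\<close>
  is an extreme point, and \<open>exp \<circ> \<phi>\<close> is a peak function that forces \<open>e\<close> into every closed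
  determining set.  Conversely, an extreme point is a maximal tripotent, since otherwise its
  spectral decomposition leaves room for moving in two opposite directions.

  The structure theory is derived from the axioms.  Hermitian operators have no Jordan blocks with
  real eigenvalue; the spectral condition makes all eigenvalues of \<open>x \<box> x\<close> real, so \<open>x \<box> x\<close> is
  diagonalisable on the finite-dimensional span of the odd powers of \<open>x\<close>.  All norm estimates come
  from \<open>\<parallel>x \<box> x\<parallel> = \<parallel>x\<parallel>\<^sup>2\<close> and from the isometries \<open>exp (i k \<pi> e \<box> e)\<close>.
\<close>

section \<open>Complex Banach spaces and exponentials of operators\<close>

lemma scaleC_minus1_left: "(-1) *\<^sub>C x = - (x::'a::complex_banach)"
  by (metis complex_vector.scale_minus_left complex_vector.scale_one)

lemma clinear_iff:
  "clinear T \<longleftrightarrow> (\<forall>x y. T (x + y) = T x + T y) \<and> (\<forall>c x. T (c *\<^sub>C x) = c *\<^sub>C T x)"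
  by (simp add: Vector_Spaces.linear_iff complex_vector.vector_space_axioms)

lemma clinear_add: "clinear T \<Longrightarrow> T (x + y) = T x + T y"
  and clinear_scaleC: "clinear T \<Longrightarrow> T (c *\<^sub>C x) = c *\<^sub>C T x"
  and clinear_scaleR: "clinear T \<Longrightarrow> T (r *\<^sub>R x) = r *\<^sub>R T x"
  by (simp_all add: clinear_iff scaleR_scaleC)

lemma clinear_diff: "clinear T \<Longrightarrow> T (x - y) = T x - T y"
  by (metis (no_types, lifting) add_diff_cancel_right' clinear_add diff_add_cancel)

lemma clinear_zero: "clinear T \<Longrightarrow> T 0 = 0"
  using clinear_diff[of T 0 0] by simp

lemma clinear_sum: "clinear T \<Longrightarrow> T (\<Sum>i\<in>I. f i) = (\<Sum>i\<in>I. T (f i))"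
  by (induction I rule: infinite_finite_induct) (simp_all add: clinear_zero clinear_add)

lemma csubspace_imp_subspace: "csubspace U \<Longrightarrow> subspace U"
  by (simp add: subspace_def complex_vector.subspace_def scaleR_scaleC)

lemma bounded_linear_scaleC_left: "bounded_linear (\<lambda>c. c *\<^sub>C (x::'a::complex_banach))"
proof (rule bounded_linear_intro[where K = "norm x"])
  show "(r *\<^sub>R c) *\<^sub>C x = r *\<^sub>R (c *\<^sub>C x)" for r :: real and c
    by (simp add: scaleR_scaleC scaleC_scaleC scaleR_conv_of_real)
qed (simp_all add: scaleC_add_left norm_scaleC)

text \<open>The exponential is summed in closed form on vectors of a Jordan block of size at most two;
  by linearity this covers all vectors to which it will be applied.\<close>

lemma op_exp_sums_jordan_pair:
  fixes w d :: "'a::complex_banach"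
  assumes T: "clinear T" and w: "T w = c *\<^sub>C w + d" and d: "T d = c *\<^sub>C d"
  shows "(\<lambda>n. (T ^^ n) w /\<^sub>R fact n) sums (exp c *\<^sub>C (w + d))"
proof -
  have pow_d: "(T ^^ n) d = c ^ n *\<^sub>C d" for n
    by (induction n) (simp_all add: T clinear_scaleC d scaleC_scaleC scaleC_one mult.commute)
  have pow_w: "(T ^^ n) w = c ^ n *\<^sub>C w + (of_nat n * c ^ (n - 1)) *\<^sub>C d" for n
  proof (induction n)
    case (Suc n)
    have "(T ^^ Suc n) w = c ^ n *\<^sub>C (c *\<^sub>C w + d) + (of_nat n * c ^ (n - 1)) *\<^sub>C (c *\<^sub>C d)"
      by (simp add: Suc.IH T clinear_add clinear_scaleC w d)
    also have "\<dots> = c ^ Suc n *\<^sub>C w + (c ^ n + of_nat n * (c ^ (n - 1) * c)) *\<^sub>C d"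
      by (simp add: scaleC_add_right scaleC_add_left scaleC_scaleC mult.commute mult.left_commute)
    also have "c ^ n + of_nat n * (c ^ (n - 1) * c) = of_nat (Suc n) * c ^ (Suc n - 1)"
      by (cases n) (simp_all add: algebra_simps)
    finally show ?case .
  qed (simp add: scaleC_one)
  have e0: "(\<lambda>n. c ^ n /\<^sub>R fact n) sums exp c"
    by (rule exp_converges)
  have e1: "(\<lambda>n. (of_nat n * c ^ (n - 1)) /\<^sub>R fact n) sums exp c"
  proof -
    have "(\<lambda>n. (of_nat (Suc n) * c ^ (Suc n - 1)) /\<^sub>R fact (Suc n)) = (\<lambda>n. c ^ n /\<^sub>R fact n)"
    proof
      fix n
      have "of_nat (Suc n) * c ^ n = (1 + real n) *\<^sub>R c ^ n"
        by (simp add: scaleR_conv_of_real)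
      then show "(of_nat (Suc n) * c ^ (Suc n - 1)) /\<^sub>R fact (Suc n) = c ^ n /\<^sub>R fact n"
        by (simp add: divide_simps)
    qed
    then show ?thesis
      using e0 sums_Suc_iff[of "\<lambda>n. (of_nat n * c ^ (n - 1)) /\<^sub>R fact n" "exp c"] by simp
  qed
  have "(\<lambda>n. (c ^ n /\<^sub>R fact n) *\<^sub>C w + ((of_nat n * c ^ (n - 1)) /\<^sub>R fact n) *\<^sub>C d)
      sums (exp c *\<^sub>C w + exp c *\<^sub>C d)"
    by (intro sums_add bounded_linear.sums[OF bounded_linear_scaleC_left] e0 e1)
  moreover have "(c ^ n /\<^sub>R fact n) *\<^sub>C w + ((of_nat n * c ^ (n - 1)) /\<^sub>R fact n) *\<^sub>C d
      = (T ^^ n) w /\<^sub>R fact n" for n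
    by (simp add: pow_w scaleR_scaleC scaleC_add_right scaleC_scaleC scaleR_conv_of_real)
  ultimately show ?thesis
    by (simp add: scaleC_add_right)
qed

lemma op_exp_jordan_pair:
  assumes "clinear T" "T w = c *\<^sub>C w + d" "T d = c *\<^sub>C d"
  shows "op_exp T w = exp c *\<^sub>C (w + d)"
  unfolding op_exp_def using op_exp_sums_jordan_pair[OF assms] by (rule sums_unique[symmetric])

lemma clinear_compose_scaleC: "clinear T \<Longrightarrow> clinear (\<lambda>y. a *\<^sub>C T y)"
  by (simp add: clinear_iff scaleC_add_right scaleC_scaleC mult.commute)

lemma op_exp_eigenvectors3:
  assumes T: "clinear T"
    and e: "T x = a *\<^sub>C x" "T y = b *\<^sub>C y" "T z = c *\<^sub>C z"
  shows "op_exp T (x + y + z) = exp a *\<^sub>C x + exp b *\<^sub>C y + exp c *\<^sub>C z"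
proof -
  have s: "(\<lambda>n. (T ^^ n) v /\<^sub>R fact n) sums (exp k *\<^sub>C v)" if "T v = k *\<^sub>C v" for k v
    using op_exp_sums_jordan_pair[of T v k 0] T that by (simp add: clinear_zero)
  have "(T ^^ n) (u + v) = (T ^^ n) u + (T ^^ n) v" for n u v
    by (induction n) (simp_all add: T clinear_add)
  then have "(\<lambda>n. (T ^^ n) (x + y + z) /\<^sub>R fact n) sums
      (exp a *\<^sub>C x + exp b *\<^sub>C y + exp c *\<^sub>C z)"
    using sums_add[OF sums_add[OF s[OF e(1)] s[OF e(2)]] s[OF e(3)]]
    by (simp add: scaleR_add_right)
  then show ?thesis
    unfolding op_exp_def by (rule sums_unique[symmetric])
qed

text \<open>On a Jordan block with real eigenvalue the exponential group grows linearly, which an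
  isometry group cannot do.\<close>

lemma hermitian_no_jordan_block:
  assumes H: "hermitian_op T" and w: "T w = complex_of_real a *\<^sub>C w + u"
    and u: "T u = complex_of_real a *\<^sub>C u"
  shows "u = 0"
proof (rule ccontr)
  assume "u \<noteq> 0"
  have T: "clinear T"
    using H by (simp add: hermitian_op_def bounded_clinear_def)
  have iso: "norm (w + (\<i> * complex_of_real t) *\<^sub>C u) = norm w" for t
  proof -
    let ?c = "\<i> * complex_of_real t"
    have "op_exp (\<lambda>y. ?c *\<^sub>C T y) w = exp (?c * complex_of_real a) *\<^sub>C (w + ?c *\<^sub>C u)"
      by (rule op_exp_jordan_pair)
        (simp_all add: T clinear_compose_scaleC w u clinear_scaleC scaleC_add_right scaleC_scaleC mult.commute)
    moreover have "norm (op_exp (\<lambda>y. ?c *\<^sub>C T y) w) = norm w"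
      using H by (simp add: hermitian_op_def)
    moreover have "cmod (exp (?c * complex_of_real a)) = 1"
      by (simp add: norm_exp_eq_Re)
    ultimately show ?thesis
      by (simp add: norm_scaleC)
  qed
  have "norm ((\<i> * complex_of_real t) *\<^sub>C u) \<le> 2 * norm w" for t
    using norm_triangle_ineq4[of "w + (\<i> * complex_of_real t) *\<^sub>C u" w] iso[of t] by simp
  from this[of "(2 * norm w + 1) / norm u"] show False
    using \<open>u \<noteq> 0\<close> by (simp add: norm_scaleC norm_mult abs_of_nonneg del: of_real_divide of_real_add of_real_mult)
qed

lemma eigenvalue_in_spectrum:
  assumes "T x = l *\<^sub>C x" "x \<noteq> 0"
  shows "l \<in> op_spectrum T"
proof -
  have False if "bounded_clinear S" "\<And>x. S (l *\<^sub>C x - T x) = x" for S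
    using that(2)[of x] that(1) assms clinear_zero[of S] by (simp add: bounded_clinear_def)
  then show ?thesis
    by (auto simp: op_spectrum_def)
qed

section \<open>Diagonalising an operator on a finite-dimensional orbit\<close>

text \<open>Induction on the number of linear factors: the image of \<open>x\<close> under one factor \<open>T - a\<close> is a sum
  of eigenvectors; dividing those with eigenvalue \<open>m \<noteq> a\<close> by \<open>m - a\<close> solves the equation for \<open>x\<close>
  up to a vector on which \<open>T - a\<close> could only act as a Jordan block.\<close>

lemma eigenvector_decomposition_of_annihilated:
  fixes T :: "'a::complex_banach \<Rightarrow> 'a"
  assumes T: "clinear T"
    and semisimple: "\<And>a w u. T w = a *\<^sub>C w + u \<Longrightarrow> T u = a *\<^sub>C u \<Longrightarrow> u = 0"
    and ann: "foldr (\<lambda>a y. T y - a *\<^sub>C y) as x = 0"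
  shows "\<exists>M v. finite M \<and> x = (\<Sum>m\<in>M. v m) \<and> (\<forall>m\<in>M. T (v m) = m *\<^sub>C v m)"
  using ann
proof (induction as arbitrary: x rule: rev_induct)
  case Nil
  then show ?case
    by (intro exI[of _ "{}"]) simp
next
  case (snoc a as)
  let ?y = "T x - a *\<^sub>C x"
  obtain M v where fin: "finite M" and y: "?y = (\<Sum>m\<in>M. v m)"
    and ev: "\<forall>m\<in>M. T (v m) = m *\<^sub>C v m"
    using snoc.IH[of ?y] snoc.prems by auto
  define w where "w m = (1 / (m - a)) *\<^sub>C v m" for m
  define x' where "x' = x - (\<Sum>m\<in>M - {a}. w m)"
  have Tw: "T (w m) = m *\<^sub>C w m" if "m \<in> M" for m
    using ev that by (simp add: w_def T clinear_scaleC scaleC_scaleC)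
  have "T (w m) - a *\<^sub>C w m = v m" if "m \<in> M - {a}" for m
  proof -
    have "T (w m) - a *\<^sub>C w m = (m - a) *\<^sub>C w m"
      using Tw that by (simp add: complex_vector.scale_left_diff_distrib)
    then show ?thesis
      using that by (simp add: w_def scaleC_scaleC scaleC_one)
  qed
  then have "(\<Sum>m\<in>M - {a}. T (w m) - a *\<^sub>C w m) = (\<Sum>m\<in>M - {a}. v m)"
    by (intro sum.cong refl)
  then have "T x' - a *\<^sub>C x' = ?y - (\<Sum>m\<in>M - {a}. v m)"
    by (simp add: x'_def T clinear_diff clinear_sum complex_vector.scale_right_diff_distrib
        complex_vector.scale_sum_right sum_subtractf algebra_simps)
  also have "\<dots> = (if a \<in> M then v a else 0)"
    using fin by (simp add: y sum_diff1)
  finally have u: "T x' - a *\<^sub>C x' = (if a \<in> M then v a else 0)" (is "_ = ?u") .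
  have "T ?u = a *\<^sub>C ?u"
    using ev by (auto simp: T clinear_zero)
  then have "?u = 0"
    using u by (intro semisimple[of x' a]) (simp_all add: algebra_simps)
  with u have Tx': "T x' = a *\<^sub>C x'"
    by simp
  define v' where "v' m = (if m = a then x' else w m)" for m
  have "(\<Sum>m\<in>insert a (M - {a}). v' m) = x' + (\<Sum>m\<in>M - {a}. v' m)"
    using fin by (subst sum.insert) (auto simp: v'_def)
  also have "(\<Sum>m\<in>M - {a}. v' m) = (\<Sum>m\<in>M - {a}. w m)"
    by (intro sum.cong) (auto simp: v'_def)
  finally have sum: "x = (\<Sum>m\<in>insert a (M - {a}). v' m)"
    by (simp add: x'_def)
  have "\<forall>m\<in>insert a (M - {a}). T (v' m) = m *\<^sub>C v' m"
    using Tx' Tw by (auto simp: v'_def)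
  then show ?case
    using sum fin by (intro exI[of _ "insert a (M - {a})"] exI[of _ v'] conjI) auto
qed

text \<open>The value \<open>p(T) x\<close> of a polynomial in an operator, by Horner's scheme.\<close>

definition poly_orbit :: "complex poly \<Rightarrow> ('a::complex_banach \<Rightarrow> 'a) \<Rightarrow> 'a \<Rightarrow> 'a"
  where "poly_orbit p T x = fold_coeffs (\<lambda>a y. a *\<^sub>C x + T y) p 0"

lemma poly_orbit_0 [simp]: "poly_orbit 0 T x = 0"
  by (simp add: poly_orbit_def)

lemma poly_orbit_pCons:
  assumes "clinear T"
  shows "poly_orbit (pCons a p) T x = a *\<^sub>C x + T (poly_orbit p T x)"
  using assms
  by (cases "p = 0 \<and> a = 0") (auto simp: poly_orbit_def clinear_zero)

lemma poly_orbit_add: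
  assumes "clinear T"
  shows "poly_orbit (p + q) T x = poly_orbit p T x + poly_orbit q T x"
  by (induction p q rule: poly_induct2)
    (simp_all add: assms poly_orbit_pCons clinear_add scaleC_add_left)

lemma poly_orbit_smult:
  assumes "clinear T"
  shows "poly_orbit (smult c p) T x = c *\<^sub>C poly_orbit p T x"
  by (induction p)
    (simp_all add: assms poly_orbit_pCons clinear_scaleC scaleC_add_right scaleC_scaleC)

lemma poly_orbit_monom:
  assumes "clinear T"
  shows "poly_orbit (monom c n) T x = c *\<^sub>C (T ^^ n) x"
  by (induction n) (simp_all add: assms poly_orbit_pCons monom_0 monom_Suc clinear_zero clinear_scaleC)

lemma poly_orbit_linear_factor:
  assumes "clinear T"
  shows "poly_orbit ([:- a, 1:] * p) T x = T (poly_orbit p T x) - a *\<^sub>C poly_orbit p T x"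
proof -
  have "[:- a, 1:] * p = smult (- a) p + pCons 0 p"
    by simp
  then show ?thesis
    by (simp only: poly_orbit_add[OF assms] poly_orbit_smult[OF assms] poly_orbit_pCons[OF assms]) simp
qed

lemma annihilating_linear_factors:
  fixes T :: "'a::complex_banach \<Rightarrow> 'a"
  assumes T: "clinear T" and "p \<noteq> 0" and "poly_orbit p T x = 0"
  shows "\<exists>as. foldr (\<lambda>a y. T y - a *\<^sub>C y) as x = 0"
proof -
  have comm: "foldr (\<lambda>a y. T y - a *\<^sub>C y) as (c *\<^sub>C y) = c *\<^sub>C foldr (\<lambda>a y. T y - a *\<^sub>C y) as y"
    for as c y
    by (induction as) (simp_all add: T clinear_scaleC complex_vector.scale_right_diff_distrib
        scaleC_scaleC mult.commute)
  have "\<exists>as c. c \<noteq> 0 \<and> poly_orbit p T x = c *\<^sub>C foldr (\<lambda>a y. T y - a *\<^sub>C y) as x"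
    using \<open>p \<noteq> 0\<close>
  proof (induction "degree p" arbitrary: p)
    case 0
    then obtain a where "p = [:a:]" "a \<noteq> 0"
      by (metis degree_0_id pCons_eq_0_iff)
    then show ?case
      by (intro exI[of _ "[]"] exI[of _ a]) (simp add: T poly_orbit_pCons clinear_zero)
  next
    case (Suc n)
    then have "\<not> constant (poly p)"
      by (simp add: constant_degree)
    then obtain a where "poly p a = 0"
      using fundamental_theorem_of_algebra by blast
    then obtain q where q: "p = [:- a, 1:] * q"
      by (metis poly_eq_0_iff_dvd dvd_def)
    with Suc.prems have "q \<noteq> 0"
      by auto
    moreover from this have "n = degree q"
      using Suc.hyps(2) q degree_mult_eq[of "[:- a, 1:]" q] by simp
    ultimately obtain as c where c: "c \<noteq> 0"
      and "poly_orbit q T x = c *\<^sub>C foldr (\<lambda>a y. T y - a *\<^sub>C y) as x"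
      using Suc.hyps(1) by blast
    then have "poly_orbit p T x = c *\<^sub>C foldr (\<lambda>a y. T y - a *\<^sub>C y) (a # as) x"
      unfolding q poly_orbit_linear_factor[OF T]
      by (simp add: T clinear_scaleC complex_vector.scale_right_diff_distrib scaleC_scaleC mult.commute)
    with c show ?case
      by blast
  qed
  then show ?thesis
    using assms(3) by (metis complex_vector.scale_eq_0_iff)
qed

lemma annihilating_polynomial:
  fixes T :: "'a::complex_banach \<Rightarrow> 'a"
  assumes T: "clinear T" and orbit: "\<And>n. (T ^^ n) x \<in> cspan S" and "finite S"
  shows "\<exists>p. p \<noteq> 0 \<and> poly_orbit p T x = 0"
proof (cases "inj_on (\<lambda>n. (T ^^ n) x) {..card S}")
  case False
  then obtain i j where ij: "i \<noteq> j" "(T ^^ i) x = (T ^^ j) x"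
    by (auto simp: inj_on_def)
  let ?p = "monom 1 i + monom (-1) j :: complex poly"
  have "coeff ?p i = 1"
    using ij(1) by simp
  then have "?p \<noteq> 0"
    by (metis coeff_0 zero_neq_one)
  moreover have "poly_orbit ?p T x = 0"
    by (simp add: T poly_orbit_add poly_orbit_monom ij(2) scaleC_one scaleC_minus1_left)
  ultimately show ?thesis
    by blast
next
  case True
  let ?B = "(\<lambda>n. (T ^^ n) x) ` {..card S}"
  have "card ?B = Suc (card S)"
    using True by (simp add: card_image)
  then have "cdependent ?B"
    using complex_vector.independent_span_bound[of S ?B] \<open>finite S\<close> orbit by fastforce
  then obtain u where u: "\<exists>v\<in>?B. u v \<noteq> 0" "(\<Sum>v\<in>?B. u v *\<^sub>C v) = 0"
    using complex_vector.dependent_finite[of ?B] by auto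
  let ?p = "\<Sum>n\<le>card S. monom (u ((T ^^ n) x)) n"
  have "poly_orbit (\<Sum>n\<in>N. monom (c n) n) T x = (\<Sum>n\<in>N. c n *\<^sub>C (T ^^ n) x)"
    if "finite N" for N c
    using that by (induction N) (simp_all add: T poly_orbit_add poly_orbit_monom)
  then have "poly_orbit ?p T x = (\<Sum>v\<in>?B. u v *\<^sub>C v)"
    using True by (simp add: sum.reindex)
  moreover obtain k where k: "k \<le> card S" "u ((T ^^ k) x) \<noteq> 0"
    using u(1) by auto
  have "coeff ?p k = (\<Sum>n\<le>card S. if k = n then u ((T ^^ n) x) else 0)"
    unfolding coeff_sum by (intro sum.cong) auto
  with k have "coeff ?p k \<noteq> 0"
    by (simp add: sum.delta')
  then have "?p \<noteq> 0"
    by (metis coeff_0)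
  ultimately show ?thesis
    using u(2) by auto
qed

text \<open>Subspaces are real here: with real eigenvalues the argument applies to the real subspace of
  self-adjoint elements as well as to complex subspaces.\<close>

lemma eigenvector_components_in_subspace:
  fixes v :: "'b \<Rightarrow> 'a::complex_banach" and m :: "'b \<Rightarrow> real"
  assumes T: "clinear T" and U: "subspace U" "\<And>y. y \<in> U \<Longrightarrow> T y \<in> U"
    and "finite J" "inj_on m J" "\<And>j. j \<in> J \<Longrightarrow> T (v j) = m j *\<^sub>R v j" "(\<Sum>j\<in>J. v j) \<in> U" "j \<in> J"
  shows "v j \<in> U"
  using assms(4-)
proof (induction J arbitrary: v j)
  case (insert k J)
  let ?s = "\<Sum>j\<in>insert k J. v j"
  have "T ?s - m k *\<^sub>R ?s = (\<Sum>j\<in>J. (m j - m k) *\<^sub>R v j)"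
    using insert.hyps insert.prems(2)
    by (simp add: T clinear_add clinear_sum scaleR_add_right scaleR_sum_right
        scaleR_left_diff_distrib sum_subtractf)
  moreover have "T ?s - m k *\<^sub>R ?s \<in> U"
    using insert.prems(3) U by (intro subspace_diff subspace_scale) auto
  ultimately have s: "(\<Sum>j\<in>J. (m j - m k) *\<^sub>R v j) \<in> U"
    by simp
  have J: "v i \<in> U" if "i \<in> J" for i
  proof -
    have "(m i - m k) *\<^sub>R v i \<in> U"
    proof (rule insert.IH[OF _ _ s that])
      show "inj_on m J"
        using insert.prems(1) by (simp add: inj_on_def)
      show "T ((m j - m k) *\<^sub>R v j) = m j *\<^sub>R (m j - m k) *\<^sub>R v j" if "j \<in> J" for j
        using that insert.prems(2) by (simp add: T clinear_scaleR mult.commute)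
    qed
    then have "(1 / (m i - m k)) *\<^sub>R (m i - m k) *\<^sub>R v i \<in> U"
      using U(1) by (rule subspace_scale[rotated])
    moreover have "m i - m k \<noteq> 0"
      using insert.prems(1) insert.hyps that by (auto simp: inj_on_def)
    ultimately show ?thesis
      by simp
  qed
  have "v k = ?s - (\<Sum>j\<in>J. v j)"
    using insert.hyps by simp
  also have "\<dots> \<in> U"
    by (rule subspace_diff[OF U(1) insert.prems(3) subspace_sum[OF U(1) J]])
  finally show ?case
    using J insert.prems(4) by auto
qed simp

section \<open>Triple identities and the Peirce decomposition\<close>

context jb_star_triple
begin

lemma triple_add_left: "triple (x + x') y z = triple x y z + triple x' y z"
  and triple_scaleC_left: "triple (c *\<^sub>C x) y z = c *\<^sub>C triple x y z"
  using triple_clinear_left by (simp_all add: clinear_iff)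

lemma triple_add_right: "triple x y (z + z') = triple x y z + triple x y z'"
  and triple_scaleC_right: "triple x y (c *\<^sub>C z) = c *\<^sub>C triple x y z"
  by (metis triple_commute triple_add_left) (metis triple_commute triple_scaleC_left)

lemma clinear_box: "clinear (triple x y)"
  by (simp add: clinear_iff triple_add_right triple_scaleC_right)

lemma triple_scaleR_left: "triple (r *\<^sub>R x) y z = r *\<^sub>R triple x y z"
  and triple_scaleR_middle: "triple x (r *\<^sub>R y) z = r *\<^sub>R triple x y z"
  and triple_scaleR_right: "triple x y (r *\<^sub>R z) = r *\<^sub>R triple x y z"
  by (simp_all add: scaleR_scaleC triple_scaleC_left triple_scaleC_middle triple_scaleC_right)

lemma additive_left: "Modules.additive (\<lambda>x. triple x y z)"
  and additive_middle: "Modules.additive (\<lambda>y. triple x y z)"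
  and additive_right: "Modules.additive (\<lambda>z. triple x y z)"
  by (simp_all add: Modules.additive_def triple_add_left triple_add_middle triple_add_right)

lemmas triple_diff_left = Modules.additive.diff[OF additive_left]
  and triple_diff_middle = Modules.additive.diff[OF additive_middle]
  and triple_diff_right = Modules.additive.diff[OF additive_right]
  and triple_minus_left = Modules.additive.minus[OF additive_left]
  and triple_minus_middle = Modules.additive.minus[OF additive_middle]
  and triple_minus_right = Modules.additive.minus[OF additive_right]
  and triple_zero_left = Modules.additive.zero[OF additive_left]
  and triple_zero_middle = Modules.additive.zero[OF additive_middle]
  and triple_zero_right = Modules.additive.zero[OF additive_right]
  and triple_sum_left = Modules.additive.sum[OF additive_left]
  and triple_sum_middle = Modules.additive.sum[OF additive_middle]
  and triple_sum_right = Modules.additive.sum[OF additive_right]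

lemmas triple_zero [simp] = triple_zero_left triple_zero_middle triple_zero_right

lemmas triple_linear = triple_add_left triple_add_middle triple_add_right
  triple_diff_left triple_diff_middle triple_diff_right
  triple_minus_left triple_minus_middle triple_minus_right
  triple_scaleR_left triple_scaleR_middle triple_scaleR_right

text \<open>The Jordan identity for \<open>{z,y,{x,y,x}}\<close>, read as an identity between operators applied to \<open>z\<close>:
  \<open>2 D(x,y)\<^sup>2 = D({x,y,x},y) + Q(x) Q(y)\<close>, where \<open>Q(x) z = {x,z,x}\<close>.\<close>

lemma double_box_square:
  "2 *\<^sub>R triple x y (triple x y z) = triple (triple x y x) y z + triple x (triple y z y) x"
proof -
  have "triple z y (triple x y x) =
      triple (triple z y x) y x - triple x (triple y z y) x + triple x y (triple z y x)"
    by (rule jordan_identity)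
  then show ?thesis
    by (simp add: scaleR_2 algebra_simps triple_commute[of z y x] triple_commute[of "triple x y z" y x]
        triple_commute[of z y "triple x y x"])
qed

lemma box_of_Q:
  "triple x x (triple x z x) = 2 *\<^sub>R triple (triple x x x) z x - triple x (triple x x z) x"
  using jordan_identity[of x x x z x] triple_commute[of x z "triple x x x"]
  by (simp add: scaleR_2)

lemma triple_cube_right:
  "triple x z (triple x x x) = 2 *\<^sub>R triple x x (triple x z x) - triple x (triple x x z) x"
  using jordan_identity[of x z x x x] triple_commute[of "triple x z x" x x]
    triple_commute[of z x x]
  by (simp add: scaleR_2 algebra_simps)

lemma hermitian_no_jordan_block_box:
  assumes "triple x x w = a *\<^sub>C w + u" "triple x x u = a *\<^sub>C u"
  shows "u = 0"
proof (rule ccontr)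
  assume "u \<noteq> 0"
  then obtain r where "a = complex_of_real r"
    using eigenvalue_in_spectrum[of "triple x x" u a] assms(2) spectrum_box by blast
  then show False
    using hermitian_no_jordan_block[OF hermitian_box] assms \<open>u \<noteq> 0\<close> by blast
qed

lemma box_eigenvalue_nonneg:
  assumes "triple x x w = a *\<^sub>C w" "w \<noteq> 0"
  shows "\<exists>r\<ge>0. a = complex_of_real r"
  using eigenvalue_in_spectrum[of "triple x x" w a] assms spectrum_box by auto

lemma norm_triple_le: "norm (triple x x z) \<le> (norm x)\<^sup>2 * norm z"
proof -
  have "bounded_linear (triple x x)"
    using hermitian_box by (simp add: hermitian_op_def bounded_clinear_def)
  from onorm[OF this, of z] show ?thesis
    by (simp add: onorm_box)
qed

text \<open>If \<open>{v,v,v} = 0\<close>, then \<open>D = v \<box> v\<close> and the quadratic map \<open>Q z = {v,z,v}\<close> annihilate each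
  other and \<open>2 D\<^sup>2 = Q\<^sup>2\<close>, so \<open>D\<close> is nilpotent; a nilpotent Hermitian operator vanishes, and
  \<open>\<parallel>D\<parallel> = \<parallel>v\<parallel>\<^sup>2\<close>.\<close>

lemma cube_eq_zero_iff: "triple v v v = 0 \<longleftrightarrow> v = 0"
proof
  assume 0: "triple v v v = 0"
  have D2: "2 *\<^sub>R triple v v (triple v v z) = triple v (triple v z v) v" for z
    using double_box_square[of v v z] 0 by simp
  have DQ: "triple v v (triple v z v) = 0" for z
  proof -
    let ?A = "triple v v (triple v z v)" and ?B = "triple v (triple v v z) v"
    have "?A = - ?B" "2 *\<^sub>R ?A = ?B"
      using box_of_Q[of v z] triple_cube_right[of v z] 0 by simp_all
    then have "3 *\<^sub>R ?A = 0"
      by (simp add: scaleR_left_distrib[of 2 1, simplified])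
    then show ?thesis
      by simp
  qed
  have D3: "triple v v (triple v v (triple v v z)) = 0" for z
  proof -
    have "2 *\<^sub>R triple v v (triple v v (triple v v z)) = triple v v (triple v (triple v z v) v)"
      by (simp flip: D2 add: triple_scaleR_right)
    then show ?thesis
      by (simp add: DQ)
  qed
  have D2': "triple v v (triple v v z) = 0" for z
    by (rule hermitian_no_jordan_block_box[of v "triple v v z" 0]) (simp_all add: D3)
  have "triple v v z = 0" for z
    by (rule hermitian_no_jordan_block_box[of v z 0]) (simp_all add: D2')
  then have "triple v v = (\<lambda>z. 0)"
    by (rule ext)
  then have "onorm (triple v v) = 0"
    by (simp add: onorm_zero)
  then show "v = 0"
    using onorm_box[of v] by simp
qed simp

definition tripotent :: "'a \<Rightarrow> bool"
  where "tripotent e \<longleftrightarrow> triple e e e = e"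

definition peirce :: "real \<Rightarrow> 'a \<Rightarrow> 'a set"
  where "peirce k e = {z. triple e e z = k *\<^sub>R z}"

lemma csubspace_peirce: "csubspace (peirce k e)"
  by (simp add: complex_vector.subspace_def peirce_def triple_add_right triple_scaleC_right
      scaleR_scaleC scaleC_add_right scaleC_scaleC mult.commute)

lemma peirce_one_iff: "z \<in> peirce 1 e \<longleftrightarrow> triple e e z = z"
  and peirce_zero_iff: "z \<in> peirce 0 e \<longleftrightarrow> triple e e z = 0"
  by (simp_all add: peirce_def)

lemma peirce_triple:
  assumes "a \<in> peirce i e" "b \<in> peirce j e" "c \<in> peirce k e"
  shows "triple a b c \<in> peirce (i - j + k) e"
  using assms jordan_identity[of e e a b c]
  by (simp add: peirce_def triple_linear scaleR_left_distrib scaleR_left_diff_distrib)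

context
  fixes e assumes e: "tripotent e"
begin

lemma box_Q_tripotent: "triple e e (triple e z e) = triple e z e"
proof -
  let ?A = "triple e e (triple e z e)" and ?B = "triple e (triple e e z) e" and ?Q = "triple e z e"
  have 1: "?A = 2 *\<^sub>R ?Q - ?B"
    using box_of_Q[of e z] e by (simp add: tripotent_def)
  have 2: "?Q = 2 *\<^sub>R ?A - ?B"
    using triple_cube_right[of e z] triple_commute[of e z e] e by (simp add: tripotent_def)
  have "3 *\<^sub>R (?A - ?Q) = (?A - (2 *\<^sub>R ?Q - ?B)) + ((2 *\<^sub>R ?A - ?B) - ?Q)"
    by (simp add: algebra_simps scaleR_left_distrib[of 2 1, simplified] scaleR_2)
  then have "3 *\<^sub>R (?A - ?Q) = 0"
    using 1 2 by simp
  then show ?thesis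
    by simp
qed

lemma Q_square_tripotent:
  "triple e (triple e z e) e = 2 *\<^sub>R triple e e (triple e e z) - triple e e z"
  using double_box_square[of e e z] e by (simp add: tripotent_def)

text \<open>Since \<open>D Q = Q\<close> for \<open>D = e \<box> e\<close>, also \<open>D Q\<^sup>2 = Q\<^sup>2\<close>, and \<open>Q\<^sup>2 = 2 D\<^sup>2 - D\<close>.\<close>

lemma box_cubic:
  "2 *\<^sub>R triple e e (triple e e (triple e e z)) =
    3 *\<^sub>R triple e e (triple e e z) - triple e e z"
proof -
  have "triple e e (triple e (triple e z e) e) = triple e (triple e z e) e"
    by (rule box_Q_tripotent)
  then have "2 *\<^sub>R triple e e (triple e e (triple e e z)) - triple e e (triple e e z)
      = 2 *\<^sub>R triple e e (triple e e z) - triple e e z"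
    by (simp add: Q_square_tripotent triple_linear)
  then show ?thesis
    by (simp add: algebra_simps scaleR_left_distrib[of 2 1, simplified])
qed

lemma peirce_eq_zero:
  assumes "k \<notin> {0, 1/2, 1}" "z \<in> peirce k e"
  shows "z = 0"
proof -
  have "(2 * k * k * k) *\<^sub>R z = (3 * k * k) *\<^sub>R z - k *\<^sub>R z"
    using box_cubic[of z] assms(2) by (simp add: peirce_def triple_linear mult.assoc)
  then have "(2 * k * k * k - 3 * k * k + k) *\<^sub>R z = 0"
    by (simp add: scaleR_left_distrib scaleR_left_diff_distrib)
  moreover have "2 * k * k * k - 3 * k * k + k = k * (2 * k - 1) * (k - 1)"
    by (simp add: algebra_simps)
  ultimately show ?thesis
    using assms(1) by auto
qed

lemma peirce_triple_eq_zero: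
  assumes "a \<in> peirce i e" "b \<in> peirce j e" "c \<in> peirce k e" "i - j + k \<notin> {0, 1/2, 1}"
  shows "triple a b c = 0"
  using peirce_triple[OF assms(1-3)] assms(4) peirce_eq_zero by blast

end

text \<open>The Lagrange polynomials of the eigenvalues \<open>1\<close>, \<open>1/2\<close>, \<open>0\<close>, evaluated at \<open>e \<box> e\<close>.\<close>

definition peirce_proj1 :: "'a \<Rightarrow> 'a \<Rightarrow> 'a"
  where "peirce_proj1 e z = 2 *\<^sub>R triple e e (triple e e z) - triple e e z"

definition peirce_proj_half :: "'a \<Rightarrow> 'a \<Rightarrow> 'a"
  where "peirce_proj_half e z = 4 *\<^sub>R triple e e z - 4 *\<^sub>R triple e e (triple e e z)"

definition peirce_proj0 :: "'a \<Rightarrow> 'a \<Rightarrow> 'a"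
  where "peirce_proj0 e z = z - 3 *\<^sub>R triple e e z + 2 *\<^sub>R triple e e (triple e e z)"

lemma peirce_decomposition:
  "z = peirce_proj1 e z + peirce_proj_half e z + peirce_proj0 e z"
proof -
  have "peirce_proj1 e z + peirce_proj_half e z + peirce_proj0 e z =
     z + (2 - 4 + 2) *\<^sub>R triple e e (triple e e z) + (4 - 1 - 3) *\<^sub>R triple e e z"
    unfolding peirce_proj1_def peirce_proj_half_def peirce_proj0_def scaleR_left_distrib
      scaleR_left_diff_distrib scaleR_one by (simp add: algebra_simps)
  then show ?thesis
    by simp
qed

lemma peirce_proj_mem:
  assumes e: "tripotent e"
  shows "peirce_proj1 e z \<in> peirce 1 e" "peirce_proj_half e z \<in> peirce (1/2) e"
    "peirce_proj0 e z \<in> peirce 0 e"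
proof -
  let ?D = "triple e e z" and ?DD = "triple e e (triple e e z)"
  have c: "triple e e ?DD = (3/2) *\<^sub>R ?DD - (1/2) *\<^sub>R ?D"
  proof -
    have "triple e e ?DD = (1/2) *\<^sub>R (2 *\<^sub>R triple e e ?DD)"
      by simp
    then show ?thesis
      unfolding box_cubic[OF e] by (simp add: scaleR_right_diff_distrib)
  qed
  have 3: "3 *\<^sub>R v = 2 *\<^sub>R v + v" "4 *\<^sub>R v = 2 *\<^sub>R v + 2 *\<^sub>R v" "6 *\<^sub>R v = 4 *\<^sub>R v + 2 *\<^sub>R v" for v :: 'a
    using scaleR_left_distrib[of 2 1 v] scaleR_left_distrib[of 2 2 v] scaleR_left_distrib[of 4 2 v]
    by simp_all
  show "peirce_proj1 e z \<in> peirce 1 e"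
    by (simp add: peirce_def peirce_proj1_def triple_linear c 3 algebra_simps)
  show "peirce_proj_half e z \<in> peirce (1/2) e"
    by (simp add: peirce_def peirce_proj_half_def triple_linear c 3 algebra_simps)
  show "peirce_proj0 e z \<in> peirce 0 e"
    by (simp add: peirce_def peirce_proj0_def triple_linear c 3 algebra_simps)
qed

lemma peirce_cases:
  assumes "tripotent e"
  obtains z1 zh z0 where "z = z1 + zh + z0" "z1 \<in> peirce 1 e" "zh \<in> peirce (1/2) e" "z0 \<in> peirce 0 e"
  using that[OF peirce_decomposition] peirce_proj_mem[OF assms] by blast

lemma clinear_peirce_proj1: "clinear (peirce_proj1 e)"
  by (simp add: clinear_iff peirce_proj1_def triple_add_right triple_scaleC_right scaleR_scaleC
      scaleC_add_right scaleC_scaleC complex_vector.scale_right_diff_distrib mult.commute)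

definition ortho :: "'a \<Rightarrow> 'a \<Rightarrow> bool"
  where "ortho a b \<longleftrightarrow> (\<forall>z. triple a b z = 0 \<and> triple b a z = 0)"

lemma ortho_commute: "ortho a b \<longleftrightarrow> ortho b a"
  by (auto simp: ortho_def)

text \<open>The degree count in the Peirce rule leaves the two cases \<open>{Z\<^sub>1,Z\<^sub>0,Z\<^sub>0}\<close> and \<open>{Z\<^sub>0,Z\<^sub>1,Z\<^sub>1}\<close>
  open.  They are settled first when the middle or left element of \<open>Z\<^sub>1\<close> is \<open>e\<close> itself; for general
  \<open>a \<in> Z\<^sub>1\<close>, the Jordan identity for \<open>{a,e,{e,b,y}}\<close> and for \<open>{b,a,{e,e,y}}\<close> reduces them to that.\<close>

lemma ortho_peirce_one_zero:
  assumes e: "tripotent e" and a: "a \<in> peirce 1 e" and b: "b \<in> peirce 0 e"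
  shows "ortho a b"
proof -
  have e1: "e \<in> peirce 1 e"
    using e by (simp add: peirce_def tripotent_def)
  have eb0: "triple e b y = 0" if b: "b \<in> peirce 0 e" and y: "y \<in> peirce 0 e" for b y
  proof -
    have "triple e b (triple e e y) =
        triple (triple e b e) e y - triple e (triple b e e) y + triple e e (triple e b y)"
      by (rule jordan_identity)
    moreover have "triple e b e = 0"
      using peirce_triple_eq_zero[OF e e1 b e1] by simp
    moreover have "triple b e e = 0"
      using b triple_commute[of b e e] by (simp add: peirce_zero_iff)
    moreover have "triple e e (triple e b y) = triple e b y"
      using peirce_triple[OF e1 b y] by (simp add: peirce_def)
    ultimately show ?thesis
      using y by (simp add: peirce_zero_iff)
  qed
  have be1: "triple b e y = 0" if b: "b \<in> peirce 0 e" and y: "y \<in> peirce 1 e" for b y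
  proof -
    have Qy: "triple e (triple e y e) e = y"
      using Q_square_tripotent[OF e, of y] y by (simp add: peirce_one_iff scaleR_2)
    define w where "w = triple e y e"
    have w: "w \<in> peirce 1 e"
      using peirce_triple[OF e1 y e1] by (simp add: w_def)
    have "triple b e (triple e w e) =
        triple (triple b e e) w e - triple e (triple e b w) e + triple e w (triple b e e)"
      by (rule jordan_identity)
    moreover have "triple b e e = 0"
      using b triple_commute[of b e e] by (simp add: peirce_zero_iff)
    moreover have "triple e b w = 0"
      using peirce_triple_eq_zero[OF e e1 b w] by simp
    ultimately show ?thesis
      by (simp add: Qy[folded w_def])
  qed
  have ab0: "triple a b y = 0" if y: "y \<in> peirce 0 e" for y
  proof -
    have "triple a e (triple e b y) =
        triple (triple a e e) b y - triple e (triple e a b) y + triple e b (triple a e y)"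
      by (rule jordan_identity)
    moreover have "triple a e e = a"
      using a triple_commute[of a e e] by (simp add: peirce_one_iff)
    moreover have "triple e (triple e a b) y = 0"
      using peirce_triple[OF e1 a b] y by (intro eb0) simp_all
    moreover have "triple a e y = 0"
      using be1[OF y a] triple_commute by metis
    ultimately show ?thesis
      using eb0[OF b y] by simp
  qed
  have ba1: "triple b a y = 0" if y: "y \<in> peirce 1 e" for y
  proof -
    have "triple b a (triple e e y) =
        triple (triple b a e) e y - triple e (triple a b e) y + triple e e (triple b a y)"
      by (rule jordan_identity)
    moreover have "triple (triple b a e) e y = 0"
      using peirce_triple[OF b a e1] y by (intro be1) simp_all
    moreover have "triple a b e = 0"
      using peirce_triple_eq_zero[OF e a b e1] by simp
    moreover have "triple e e (triple b a y) = 0"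
      using peirce_triple[OF b a y] by (simp add: peirce_def)
    ultimately show ?thesis
      using y by (simp add: peirce_one_iff)
  qed
  have "triple a b z = 0 \<and> triple b a z = 0" for z
  proof -
    obtain z1 zh z0 where z: "z = z1 + zh + z0" "z1 \<in> peirce 1 e" "zh \<in> peirce (1/2) e" "z0 \<in> peirce 0 e"
      using peirce_cases[OF e] by blast
    have "triple a b z1 = 0" "triple a b zh = 0" "triple b a zh = 0" "triple b a z0 = 0"
      using peirce_triple_eq_zero[OF e a b z(2)] peirce_triple_eq_zero[OF e a b z(3)]
        peirce_triple_eq_zero[OF e b a z(3)] peirce_triple_eq_zero[OF e b a z(4)] by simp_all
    then show ?thesis
      using ab0[OF z(4)] ba1[OF z(2)] by (simp add: z(1) triple_add_right)
  qed
  then show ?thesis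
    by (simp add: ortho_def)
qed

lemma ortho_tripotentI:
  assumes "tripotent e" "triple e e f = 0"
  shows "ortho e f"
  using ortho_peirce_one_zero[OF assms(1), of e f] assms by (simp add: peirce_def tripotent_def)

lemma tripotent_exp_isometry:
  assumes z: "z1 \<in> peirce 1 e" "zh \<in> peirce (1/2) e" "z0 \<in> peirce 0 e"
  shows "norm (exp (\<i> * complex_of_real t) *\<^sub>C z1 + exp (\<i> * complex_of_real (t / 2)) *\<^sub>C zh + z0) =
    norm (z1 + zh + z0)"
proof -
  let ?T = "\<lambda>y. (\<i> * complex_of_real t) *\<^sub>C triple e e y"
  have "op_exp ?T (z1 + zh + z0) = exp (\<i> * complex_of_real t) *\<^sub>C z1 +
      exp (\<i> * complex_of_real (t / 2)) *\<^sub>C zh + exp 0 *\<^sub>C z0"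
    using z by (intro op_exp_eigenvectors3 clinear_compose_scaleC clinear_box)
      (simp_all add: peirce_def scaleR_scaleC scaleC_scaleC)
  moreover have "norm (op_exp ?T (z1 + zh + z0)) = norm (z1 + zh + z0)"
    using hermitian_box[of e] by (simp add: hermitian_op_def)
  ultimately show ?thesis
    by (simp add: scaleC_one)
qed

text \<open>The isometries \<open>exp (i k \<pi> e \<box> e)\<close>, \<open>k = 1, 2, 3\<close>, multiply the Peirce parts by the
  characters \<open>(-1)\<^sup>k\<close>, \<open>i\<^sup>k\<close>, \<open>1\<close>.\<close>

lemma peirce_reflections:
  assumes z: "z1 \<in> peirce 1 e" "zh \<in> peirce (1/2) e" "z0 \<in> peirce 0 e"
  shows "norm (- z1 + \<i> *\<^sub>C zh + z0) = norm (z1 + zh + z0)"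
    "norm (z1 - zh + z0) = norm (z1 + zh + z0)"
    "norm (- z1 - \<i> *\<^sub>C zh + z0) = norm (z1 + zh + z0)"
proof -
  have e1: "exp (\<i> * complex_of_real pi) = -1" "exp (\<i> * complex_of_real (pi / 2)) = \<i>"
    by (simp_all add: exp_eq_polar cis_conv_exp[symmetric] flip: cis_conv_exp)
  have e3: "exp (\<i> * complex_of_real (2 * pi)) = 1"
    by (metis cis_2pi cis_conv_exp)
  have e4: "exp (\<i> * complex_of_real (3 * pi)) = -1" "exp (\<i> * complex_of_real (3 * pi / 2)) = - \<i>"
  proof -
    have "\<i> * complex_of_real (3 * pi) = \<i> * complex_of_real pi + \<i> * complex_of_real (2 * pi)"
      "\<i> * complex_of_real (3 * pi / 2) = \<i> * complex_of_real pi + \<i> * complex_of_real (pi / 2)"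
      by (simp_all add: algebra_simps)
    then show "exp (\<i> * complex_of_real (3 * pi)) = -1" "exp (\<i> * complex_of_real (3 * pi / 2)) = - \<i>"
      by (simp_all only: exp_add e1 e3) simp_all
  qed
  show "norm (- z1 + \<i> *\<^sub>C zh + z0) = norm (z1 + zh + z0)"
    using tripotent_exp_isometry[OF z, of pi] unfolding e1 by (simp add: scaleC_minus1_left)
  show "norm (z1 - zh + z0) = norm (z1 + zh + z0)"
    using tripotent_exp_isometry[OF z, of "2 * pi"] e1 e3 by (simp add: scaleC_minus1_left scaleC_one)
  show "norm (- z1 - \<i> *\<^sub>C zh + z0) = norm (z1 + zh + z0)"
    using tripotent_exp_isometry[OF z, of "3 * pi"] unfolding e4 by (simp add: scaleC_minus1_left)
qed

text \<open>The projection onto \<open>Z\<^sub>1\<close> is the average, with signs, of the identity and these three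
  isometries.\<close>

lemma norm_peirce_one_le:
  assumes z: "z1 \<in> peirce 1 e" "zh \<in> peirce (1/2) e" "z0 \<in> peirce 0 e"
  shows "norm z1 \<le> norm (z1 + zh + z0)"
proof -
  let ?z = "z1 + zh + z0" and ?a = "- z1 + \<i> *\<^sub>C zh + z0" and ?b = "z1 - zh + z0"
    and ?c = "- z1 - \<i> *\<^sub>C zh + z0"
  have "4 *\<^sub>R z1 = (?z - ?a) + (?b - ?c)"
    using scaleR_left_distrib[of 2 2 z1] by (simp add: scaleR_2)
  then have "4 * norm z1 = norm ((?z - ?a) + (?b - ?c))"
    by (metis norm_scaleR abs_numeral)
  also have "\<dots> \<le> (norm ?z + norm ?a) + (norm ?b + norm ?c)"
    by (intro norm_triangle_le add_mono norm_triangle_ineq4)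
  finally show ?thesis
    using peirce_reflections[OF z] by simp
qed

text \<open>On the eigenvalues \<open>0, 1/2, 1\<close> the identity function agrees with
  \<open>\<lambda> \<mapsto> 1/2 - cos (\<pi> \<lambda>) / 2\<close>; so \<open>e \<box> e\<close> is a combination of isometries with coefficients of
  total modulus \<open>1\<close>.\<close>

lemma norm_box_tripotent_le:
  assumes e: "tripotent e"
  shows "norm (triple e e z) \<le> norm z"
proof -
  obtain z1 zh z0 where z: "z = z1 + zh + z0" "z1 \<in> peirce 1 e" "zh \<in> peirce (1/2) e" "z0 \<in> peirce 0 e"
    using peirce_cases[OF e] by blast
  let ?a = "- z1 + \<i> *\<^sub>C zh + z0" and ?c = "- z1 - \<i> *\<^sub>C zh + z0"
  have "triple e e z = z1 + (1/2) *\<^sub>R zh"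
    using z by (simp add: triple_linear peirce_def)
  then have "4 *\<^sub>R triple e e z = (z + z) - (?a + ?c)"
    using scaleR_left_distrib[of 2 2 z1] by (simp add: scaleR_add_right z(1) scaleR_2)
  then have "4 * norm (triple e e z) = norm ((z + z) - (?a + ?c))"
    by (metis norm_scaleR abs_numeral)
  also have "\<dots> \<le> (norm z + norm z) + (norm ?a + norm ?c)"
    by (intro order_trans[OF norm_triangle_ineq4] add_mono norm_triangle_ineq)
  finally show ?thesis
    using peirce_reflections[OF z(2-4)] by (simp add: z(1))
qed

lemma norm_tripotent_le_1:
  assumes e: "tripotent e"
  shows "norm e \<le> 1"
proof -
  have "onorm (triple e e) \<le> 1"
    using norm_box_tripotent_le[OF e] by (intro onorm_bound) simp_all
  then show ?thesis
    by (simp add: onorm_box power_le_one_iff abs_le_square_iff)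
qed

lemma norm_tripotent_eq_1:
  assumes e: "tripotent e" and "e \<noteq> 0"
  shows "norm e = 1"
proof -
  have "norm e \<le> (norm e)\<^sup>2 * norm e"
    using norm_triple_le[of e e] e by (simp add: tripotent_def)
  then have "1 \<le> (norm e)\<^sup>2"
    using \<open>e \<noteq> 0\<close> by (simp add: mult_le_cancel_right1)
  then show ?thesis
    using norm_tripotent_le_1[OF e] abs_le_square_iff[of 1 "norm e"] by simp
qed


section \<open>Spectral decomposition into orthogonal tripotents\<close>

text \<open>Power associativity.  Write \<open>x\<^sub>n = T\<^sup>n x\<close> for \<open>T = x \<box> x\<close>.  Suppose that for \<open>a + b = n\<close> the
  operator \<open>x\<^sub>a \<box> x\<^sub>b\<close> does not depend on \<open>a\<close>, and let \<open>K\<close> be its commutator with \<open>T\<close>.  By the Jordan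
  identity \<open>K = x\<^sub>a\<^sub>+\<^sub>1 \<box> x\<^sub>b - x\<^sub>a \<box> x\<^sub>b\<^sub>+\<^sub>1\<close> for each such \<open>a\<close>; summing, the right-hand sides telescope to
  \<open>(n + 1) K = x\<^sub>n\<^sub>+\<^sub>1 \<box> x - x \<box> x\<^sub>n\<^sub>+\<^sub>1\<close>.  The Jordan identity with the two operators exchanged says that
  the same difference is \<open>- K\<close>.  So \<open>K = 0\<close>, which is the statement for \<open>n + 1\<close>.\<close>

lemma box_powers_shift:
  fixes x defines "p \<equiv> \<lambda>n. (triple x x ^^ n) x"
  shows "triple (p (Suc a)) (p b) z = triple (p a) (p (Suc b)) z"
proof -
  have T: "triple x x (p n) = p (Suc n)" for n
    by (simp add: p_def)
  have p0: "p 0 = x"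
    by (simp add: p_def)
  have comm: "triple x x (triple (p a) (p b) z) - triple (p a) (p b) (triple x x z) =
      triple (p (Suc a)) (p b) z - triple (p a) (p (Suc b)) z" for a b z
    using jordan_identity[of x x "p a" "p b" z] by (simp add: T)
  have "\<forall>a b z. a + b = n \<longrightarrow> triple (p (Suc a)) (p b) z = triple (p a) (p (Suc b)) z" for n
  proof (induction n rule: less_induct)
    case (less n)
    have eq: "triple (p a) (p b) z = triple (p n) (p 0) z" if "a + b = n" for a b z
      using that
    proof (induction b arbitrary: a)
      case (Suc b)
      have "triple (p a) (p (Suc b)) z = triple (p (Suc a)) (p b) z"
        using less.IH[rule_format, of "a + b" a b z] Suc.prems by simp
      also have "\<dots> = triple (p n) (p 0) z"
        using Suc.prems by (intro Suc.IH) simp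
      finally show ?case .
    qed simp
    define K where "K z = triple x x (triple (p n) (p 0) z) - triple (p n) (p 0) (triple x x z)" for z
    have K: "triple (p (Suc a)) (p b) z - triple (p a) (p (Suc b)) z = K z" if "a + b = n" for a b z
      using comm[of a b z] eq[OF that] by (simp add: K_def)
    have "K z = 0" for z
    proof -
      define g where "g a = triple (p a) (p (Suc n - a)) z" for a
      have "(\<Sum>a<Suc n. g (Suc a) - g a) = (\<Sum>a<Suc n. K z)"
      proof (intro sum.cong refl)
        fix a assume "a \<in> {..<Suc n}"
        then show "g (Suc a) - g a = K z"
          using K[of a "n - a" z] by (simp add: g_def Suc_diff_le less_Suc_eq_le)
      qed
      then have tele: "g (Suc n) - g 0 = real (Suc n) *\<^sub>R K z"
        by (simp only: sum_lessThan_telescope sum_constant_scaleR card_lessThan)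
      have pn: "triple x (p n) x = p (Suc n)"
      proof -
        have "triple x (p n) x = triple (p 0) (p n) (p 0)"
          by (simp add: p0)
        also have "\<dots> = triple (p n) (p 0) (p 0)"
          by (rule eq) simp
        also have "\<dots> = p (Suc n)"
          using triple_commute[of "p n" x x] by (simp add: p0 T)
        finally show ?thesis .
      qed
      have "triple (p n) x (triple x x z) =
          triple (triple (p n) x x) x z - triple x (triple x (p n) x) z + triple x x (triple (p n) x z)"
        by (rule jordan_identity)
      moreover have "triple (p n) x x = p (Suc n)"
        using triple_commute[of "p n" x x] by (simp add: T)
      ultimately have "K z = - (g (Suc n) - g 0)"
        by (simp add: K_def g_def p0 pn)
      then have "(real (Suc n) + 1) *\<^sub>R K z = 0"
        unfolding scaleR_left_distrib tele[symmetric] by simp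
      then show "K z = 0"
        by (simp add: add_eq_0_iff)
    qed
    then show ?case
      using K by (metis eq_iff_diff_eq_0)
  qed
  then show ?thesis
    by blast
qed

text \<open>The operator \<open>x \<box> x\<close> can be moved across \<open>u \<box> w\<close> for \<open>u, w\<close> in the span of the orbit of
  \<open>x\<close>; so eigenvectors in this span with different real eigenvalues are orthogonal.\<close>

lemma box_orbit_shift:
  fixes x defines "U \<equiv> cspan (range (\<lambda>n. (triple x x ^^ n) x))"
  assumes u: "u \<in> U" and w: "w \<in> U"
  shows "triple (triple x x u) w z = triple u (triple x x w) z"
proof -
  have 1: "triple (triple x x u) ((triple x x ^^ b) x) z = triple u (triple x x ((triple x x ^^ b) x)) z" for b
    using u unfolding U_def
  proof (induction rule: complex_vector.span_induct_alt)
    case (step c y v)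
    then show ?case
      using box_powers_shift[where x = x and b = b and z = z]
      by (auto simp: triple_add_left triple_add_right triple_scaleC_left triple_scaleC_right)
  qed simp
  show ?thesis
    using w unfolding U_def
  proof (induction rule: complex_vector.span_induct_alt)
    case (step c y v)
    then show ?case
      using 1 by (auto simp: triple_add_middle triple_add_right triple_scaleC_middle triple_scaleC_right)
  qed simp
qed

definition orthogonal_tripotents :: "'a set \<Rightarrow> bool"
  where "orthogonal_tripotents E \<longleftrightarrow> finite E \<and> (\<forall>e\<in>E. tripotent e \<and> e \<noteq> 0) \<and>
    (\<forall>e\<in>E. \<forall>f\<in>E. e \<noteq> f \<longrightarrow> ortho e f)"

lemma orthogonal_tripotentsD:
  assumes "orthogonal_tripotents E"
  shows "finite E" "e \<in> E \<Longrightarrow> tripotent e" "e \<in> E \<Longrightarrow> e \<noteq> 0"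
    "e \<in> E \<Longrightarrow> f \<in> E \<Longrightarrow> e \<noteq> f \<Longrightarrow> ortho e f"
  using assms by (auto simp: orthogonal_tripotents_def)

text \<open>Finite rank enters only here and in the bound on orthogonal systems below: the odd powers
  of \<open>z\<close> span a finite-dimensional space.\<close>

lemma spectral_decomposition:
  assumes "rank_le triple r"
  shows "\<exists>E l. orthogonal_tripotents E \<and> (\<forall>e\<in>E. 0 < l e) \<and> inj_on l E \<and> z = (\<Sum>e\<in>E. l e *\<^sub>R e)"
proof -
  let ?T = "triple z z"
  let ?p = "\<lambda>n. (?T ^^ n) z"
  let ?U = "cspan (range ?p)"
  obtain U S where U: "subtriple triple U" "z \<in> U" and S: "finite S" "cspan S = U"
    using assms unfolding rank_le_def cdim_le_def by blast
  have p: "?p n \<in> cspan S" for n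
    using U S by (induction n) (auto simp: subtriple_def)
  obtain q where "q \<noteq> 0" "poly_orbit q ?T z = 0"
    using annihilating_polynomial[OF clinear_box p S(1)] by blast
  then obtain as where "foldr (\<lambda>a y. ?T y - a *\<^sub>C y) as z = 0"
    using annihilating_linear_factors[OF clinear_box] by blast
  then have "\<exists>M v. finite M \<and> z = (\<Sum>m\<in>M. v m) \<and> (\<forall>m\<in>M. ?T (v m) = m *\<^sub>C v m)"
    by (intro eigenvector_decomposition_of_annihilated clinear_box)
      (rule hermitian_no_jordan_block_box)
  then obtain M v where fin: "finite M" and z: "z = (\<Sum>m\<in>M. v m)"
    and ev: "\<And>m. m \<in> M \<Longrightarrow> ?T (v m) = m *\<^sub>C v m"
    by blast
  define N where "N = {m \<in> M. v m \<noteq> 0}"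
  have zN: "z = (\<Sum>m\<in>N. v m)"
    unfolding z N_def using fin by (intro sum.mono_neutral_right) auto
  have [simp]: "finite N"
    using fin by (simp add: N_def)
  have real: "\<exists>r\<ge>0. m = complex_of_real r" if "m \<in> N" for m
    using that box_eigenvalue_nonneg[OF ev] by (auto simp: N_def)
  have Re: "complex_of_real (Re m) = m" "0 \<le> Re m" if "m \<in> N" for m
    using real[OF that] by auto
  have Tv: "?T (v m) = Re m *\<^sub>R v m" if "m \<in> N" for m
    using ev Re[OF that] that by (simp add: N_def scaleR_scaleC)
  have inj: "inj_on Re N"
    by (rule inj_on_inverseI[of _ complex_of_real]) (simp add: Re)
  have vU: "v m \<in> ?U" if "m \<in> N" for m
  proof (rule eigenvector_components_in_subspace[OF clinear_box _ _ _ inj Tv _ that])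
    show "subspace ?U"
      by (intro csubspace_imp_subspace) simp
    show "?T y \<in> ?U" if "y \<in> ?U" for y
      using that
    proof (induction rule: complex_vector.span_induct_alt)
      case (step c y w)
      then obtain n where "y = ?p n"
        by auto
      then have "?T y = ?p (Suc n)"
        by simp
      then have "?T y \<in> ?U"
        by (metis complex_vector.span_base rangeI)
      with step(2) show ?case
        by (simp add: triple_add_right triple_scaleC_right complex_vector.span_add complex_vector.span_scale)
    qed (simp add: complex_vector.span_zero)
    have "?p 0 \<in> ?U"
      by (intro complex_vector.span_base) blast
    then show "(\<Sum>m\<in>N. v m) \<in> ?U"
      using zN by simp
  qed simp_all
  have orth: "triple (v m) (v m') y = 0" if "m \<in> N" "m' \<in> N" "m \<noteq> m'" for m m' y
  proof -
    have "Re m *\<^sub>R triple (v m) (v m') y = Re m' *\<^sub>R triple (v m) (v m') y"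
      using box_orbit_shift[OF vU vU, of m m' y] that
      by (simp add: Tv triple_scaleR_left triple_scaleR_middle)
    then show ?thesis
      using inj_onD[OF inj] that by auto
  qed
  have cube: "triple (v m) (v m) (v m) = Re m *\<^sub>R v m" if m: "m \<in> N" for m
  proof -
    have "Re m *\<^sub>R v m = (\<Sum>i\<in>N. triple (v i) z (v m))"
      using Tv[OF m] by (subst (asm) zN) (simp add: triple_sum_left)
    also have "\<dots> = (\<Sum>i\<in>N. triple (v m) z (v i))"
      by (intro sum.cong refl triple_commute)
    also have "\<dots> = (\<Sum>i\<in>N. \<Sum>j\<in>N. triple (v m) (v j) (v i))"
      by (subst zN) (simp add: triple_sum_middle)
    also have "\<dots> = (\<Sum>i\<in>N. \<Sum>j\<in>N. if j = m then if i = m then triple (v m) (v m) (v m) else 0 else 0)"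
    proof (intro sum.cong refl)
      fix i j assume ij: "i \<in> N" "j \<in> N"
      show "triple (v m) (v j) (v i) = (if j = m then if i = m then triple (v m) (v m) (v m) else 0 else 0)"
        using orth[OF m ij(2)] orth[OF ij(1) m] triple_commute[of "v m" "v m" "v i"] by auto
    qed
    also have "\<dots> = triple (v m) (v m) (v m)"
      using m by simp
    finally show ?thesis
      by simp
  qed
  have pos: "Re m > 0" if "m \<in> N" for m
  proof (rule ccontr)
    assume "\<not> Re m > 0"
    then have "triple (v m) (v m) (v m) = 0"
      using Re(2)[OF that] cube[OF that] by simp
    then show False
      using that by (simp add: cube_eq_zero_iff N_def)
  qed
  define e where "e m = (1 / sqrt (Re m)) *\<^sub>R v m" for m
  have e0: "e m \<noteq> 0" if "m \<in> N" for m
    using that pos[OF that] by (simp add: e_def N_def)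
  have te: "tripotent (e m)" if "m \<in> N" for m
    using pos[OF that] cube[OF that] by (simp add: tripotent_def e_def triple_linear)
  have oe: "ortho (e m) (e m')" if "m \<in> N" "m' \<in> N" "m \<noteq> m'" for m m'
    using that by (simp add: ortho_def e_def triple_linear orth)
  have inje: "inj_on e N"
  proof (rule inj_onI, rule ccontr)
    fix m m' assume *: "m \<in> N" "m' \<in> N" "e m = e m'" "m \<noteq> m'"
    then have "triple (e m) (e m) (e m) = 0"
      using oe[OF *(1,2,4)] by (simp add: ortho_def)
    then show False
      using e0 * by (simp add: cube_eq_zero_iff)
  qed
  define l where "l f = sqrt (Re (inv_into N e f))" for f
  have l: "l (e m) = sqrt (Re m)" if "m \<in> N" for m
    using that inje by (simp add: l_def)
  have "orthogonal_tripotents (e ` N)"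
    using e0 te oe by (auto simp: orthogonal_tripotents_def)
  moreover have "\<forall>f\<in>e ` N. 0 < l f"
    using l pos by simp
  moreover have "inj_on l (e ` N)"
  proof (rule inj_onI, elim imageE, hypsubst)
    fix m m' assume *: "m \<in> N" "m' \<in> N" "l (e m) = l (e m')"
    then have "Re m = Re m'"
      by (simp add: l)
    then show "e m = e m'"
      using inj_onD[OF inj] * by blast
  qed
  moreover have "z = (\<Sum>f\<in>e ` N. l f *\<^sub>R f)"
  proof -
    have "(\<Sum>f\<in>e ` N. l f *\<^sub>R f) = (\<Sum>m\<in>N. v m)"
      unfolding sum.reindex[OF inje] comp_def
    proof (intro sum.cong refl)
      fix m assume "m \<in> N"
      then show "l (e m) *\<^sub>R e m = v m"
        using pos[of m] by (simp add: l) (simp add: e_def)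
    qed
    then show ?thesis
      using zN by simp
  qed
  ultimately show ?thesis
    by (intro exI conjI)
qed

section \<open>Orthogonal systems of tripotents\<close>

lemma box_combination:
  assumes E: "orthogonal_tripotents E"
  shows "triple (\<Sum>e\<in>E. c e *\<^sub>C e) (\<Sum>e\<in>E. d e *\<^sub>C e) z = (\<Sum>e\<in>E. (c e * cnj (d e)) *\<^sub>C triple e e z)"
proof -
  note fin = orthogonal_tripotentsD(1)[OF E]
  have "triple (\<Sum>e\<in>E. c e *\<^sub>C e) (\<Sum>e\<in>E. d e *\<^sub>C e) z =
      (\<Sum>e\<in>E. \<Sum>f\<in>E. (c e * cnj (d f)) *\<^sub>C triple e f z)"
    by (simp add: triple_sum_left triple_sum_middle triple_scaleC_left triple_scaleC_middle
        complex_vector.scale_sum_right scaleC_scaleC) (subst sum.swap, simp add: mult.commute)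
  also have "\<dots> = (\<Sum>e\<in>E. \<Sum>f\<in>E. if f = e then (c e * cnj (d e)) *\<^sub>C triple e e z else 0)"
  proof (intro sum.cong refl)
    fix e f assume "e \<in> E" "f \<in> E"
    then show "(c e * cnj (d f)) *\<^sub>C triple e f z =
        (if f = e then (c e * cnj (d e)) *\<^sub>C triple e e z else 0)"
      using orthogonal_tripotentsD(4)[OF E, of e f] by (auto simp: ortho_def)
  qed
  also have "\<dots> = (\<Sum>e\<in>E. (c e * cnj (d e)) *\<^sub>C triple e e z)"
    using fin by simp
  finally show ?thesis .
qed

lemma box_sum_tripotents:
  assumes E: "orthogonal_tripotents E"
  shows "triple (\<Sum>E) (\<Sum>E) z = (\<Sum>e\<in>E. triple e e z)"
  using box_combination[OF E, of "\<lambda>_. 1" "\<lambda>_. 1" z] by (simp add: scaleC_one)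

lemma box_member:
  assumes E: "orthogonal_tripotents E" and "e \<in> E" "f \<in> E"
  shows "triple e e f = (if e = f then f else 0)"
  using orthogonal_tripotentsD(2,4)[OF E] assms(2,3) triple_commute[of e e f]
  by (auto simp: tripotent_def ortho_def)

lemma box_combination_member:
  assumes E: "orthogonal_tripotents E" and f: "f \<in> E"
  shows "triple (\<Sum>e\<in>E. c e *\<^sub>C e) (\<Sum>e\<in>E. d e *\<^sub>C e) f = (c f * cnj (d f)) *\<^sub>C f"
proof -
  have "triple (\<Sum>e\<in>E. c e *\<^sub>C e) (\<Sum>e\<in>E. d e *\<^sub>C e) f =
      (\<Sum>e\<in>E. if e = f then (c f * cnj (d f)) *\<^sub>C f else 0)"
    unfolding box_combination[OF E] using box_member[OF E _ f] by (intro sum.cong) auto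
  then show ?thesis
    using f orthogonal_tripotentsD(1)[OF E] by simp
qed

lemma unimodular_mult_cnj: "cmod c = 1 \<Longrightarrow> c * cnj c = 1"
  by (simp add: complex_norm_square[symmetric])

lemma
  assumes E: "orthogonal_tripotents E" and c: "\<And>e. e \<in> E \<Longrightarrow> cmod (c e) = 1"
  shows box_unimodular_combination:
      "triple (\<Sum>e\<in>E. c e *\<^sub>C e) (\<Sum>e\<in>E. c e *\<^sub>C e) z = triple (\<Sum>E) (\<Sum>E) z"
    and tripotent_unimodular_combination: "tripotent (\<Sum>e\<in>E. c e *\<^sub>C e)"
proof -
  have c1: "c e * cnj (c e) = 1" if "e \<in> E" for e
    using c[OF that] by (rule unimodular_mult_cnj)
  show "triple (\<Sum>e\<in>E. c e *\<^sub>C e) (\<Sum>e\<in>E. c e *\<^sub>C e) z = triple (\<Sum>E) (\<Sum>E) z"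
    using c1 by (simp add: box_combination[OF E] box_sum_tripotents[OF E] scaleC_one)
  have "triple (\<Sum>e\<in>E. c e *\<^sub>C e) (\<Sum>e\<in>E. c e *\<^sub>C e) (\<Sum>e\<in>E. c e *\<^sub>C e) =
      (\<Sum>f\<in>E. c f *\<^sub>C ((c f * cnj (c f)) *\<^sub>C f))"
    by (rule trans[OF triple_sum_right], intro sum.cong refl)
      (simp add: triple_scaleC_right box_combination_member[OF E])
  then show "tripotent (\<Sum>e\<in>E. c e *\<^sub>C e)"
    using c1 by (simp add: tripotent_def scaleC_one)
qed

lemma tripotent_sum: "orthogonal_tripotents E \<Longrightarrow> tripotent (\<Sum>E)"
  using tripotent_unimodular_combination[of E "\<lambda>_. 1"] by (simp add: scaleC_one)

lemma unit_disc_average: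
  assumes "cmod z \<le> 1"
  shows "\<exists>u w. cmod u = 1 \<and> cmod w = 1 \<and> z = (u + w) / 2"
proof -
  define s where "s = (if z = 0 then 1 else z / cmod z)"
  define h where "h = \<i> * complex_of_real (sqrt (1 - (cmod z)\<^sup>2))"
  have s: "cmod s = 1" "z = s * cmod z"
    by (auto simp: s_def norm_divide)
  have "(cmod z)\<^sup>2 \<le> 1"
    using assms by (simp add: power_le_one)
  then have h: "cmod (complex_of_real (cmod z) + h) = 1" "cmod (complex_of_real (cmod z) - h) = 1"
    by (simp_all add: h_def cmod_def)
  have "(s * (cmod z + h) + s * (cmod z - h)) / 2 = z"
    using s(2)[symmetric] by (simp add: field_simps)
  then show ?thesis
    using s(1) h by (metis norm_mult mult_1)
qed

text \<open>The closed polydisc spanned by an orthogonal system is the convex hull of the torus, whose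
  points are tripotents.\<close>

lemma norm_combination_le_1:
  assumes E: "orthogonal_tripotents E" and c: "\<And>e. e \<in> E \<Longrightarrow> cmod (c e) \<le> 1"
  shows "norm (\<Sum>e\<in>E. c e *\<^sub>C e) \<le> 1"
proof -
  have "norm (\<Sum>e\<in>E. c e *\<^sub>C e) \<le> 1"
    if "finite F" "\<And>e. e \<in> F \<Longrightarrow> cmod (c e) \<le> 1" "\<And>e. e \<in> E - F \<Longrightarrow> cmod (c e) = 1" for F c
    using that
  proof (induction F arbitrary: c)
    case empty
    then show ?case
      by (intro norm_tripotent_le_1 tripotent_unimodular_combination E) simp
  next
    case (insert x F)
    obtain u w where uw: "cmod u = 1" "cmod w = 1" "c x = (u + w) / 2"
      using unit_disc_average insert.prems(1) by blast
    let ?s = "\<lambda>c. \<Sum>e\<in>E. c e *\<^sub>C e"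
    have "norm (?s (c(x := a))) \<le> 1" if "cmod a = 1" for a
      using insert.prems insert.hyps that by (intro insert.IH) auto
    then have "norm (?s (c(x := u)) + ?s (c(x := w))) \<le> 2"
      using uw by (intro norm_triangle_le) (metis add_mono one_add_one)
    moreover have "2 *\<^sub>R ?s c = ?s (c(x := u)) + ?s (c(x := w))"
      unfolding scaleR_sum_right sum.distrib[symmetric]
      by (intro sum.cong refl) (auto simp: scaleR_scaleC scaleC_scaleC uw(3) simp flip: scaleC_add_left)
    ultimately have "norm (2 *\<^sub>R ?s c) \<le> 2"
      by simp
    then show ?case
      by simp
  qed
  from this[of E c] show ?thesis
    using c orthogonal_tripotentsD(1)[OF E] by simp
qed

lemma norm_combination_le:
  assumes E: "orthogonal_tripotents E" and c: "\<And>e. e \<in> E \<Longrightarrow> cmod (c e) \<le> R" and "0 < R"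
  shows "norm (\<Sum>e\<in>E. c e *\<^sub>C e) \<le> R"
proof -
  have "norm (\<Sum>e\<in>E. (c e / complex_of_real R) *\<^sub>C e) \<le> 1"
    using c \<open>0 < R\<close> by (intro norm_combination_le_1[OF E]) (simp add: norm_divide)
  moreover have "(\<Sum>e\<in>E. c e *\<^sub>C e) = R *\<^sub>R (\<Sum>e\<in>E. (c e / complex_of_real R) *\<^sub>C e)"
    unfolding scaleR_sum_right using \<open>0 < R\<close>
    by (intro sum.cong refl) (simp add: scaleR_scaleC scaleC_scaleC)
  ultimately show ?thesis
    using \<open>0 < R\<close> by (simp add: mult_left_le)
qed

lemma coefficient_le_norm:
  assumes E: "orthogonal_tripotents E" and f: "f \<in> E"
  shows "cmod (c f) \<le> norm (\<Sum>e\<in>E. c e *\<^sub>C e)"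
proof -
  have "norm ((c f * cnj (c f)) *\<^sub>C f) \<le> (norm (\<Sum>e\<in>E. c e *\<^sub>C e))\<^sup>2 * norm f"
    using norm_triple_le[of "\<Sum>e\<in>E. c e *\<^sub>C e" f] by (simp add: box_combination_member[OF E f])
  then have "(cmod (c f))\<^sup>2 \<le> (norm (\<Sum>e\<in>E. c e *\<^sub>C e))\<^sup>2"
    using orthogonal_tripotentsD(3)[OF E f] by (simp add: norm_scaleC norm_mult power2_eq_square)
  then show ?thesis
    by (rule power2_le_imp_le) simp
qed

lemma real_combination: "(\<Sum>e\<in>E. l e *\<^sub>R e) = (\<Sum>e\<in>E. complex_of_real (l e) *\<^sub>C e)"
  by (simp add: scaleR_scaleC)

text \<open>The vectors \<open>l\<^sub>e e\<close> are eigenvectors of \<open>z \<box> z\<close> with distinct eigenvalues \<open>l\<^sub>e\<^sup>2\<close>.  This is how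
  membership of an element in a Peirce space passes to its spectral tripotents.\<close>

lemma combination_members_in_subspace:
  assumes E: "orthogonal_tripotents E" and l: "\<And>e. e \<in> E \<Longrightarrow> 0 < l e" and inj: "inj_on l E"
    and z: "z = (\<Sum>e\<in>E. l e *\<^sub>R e)" and W: "subspace W" "z \<in> W" "\<And>y. y \<in> W \<Longrightarrow> triple z z y \<in> W"
    and e: "e \<in> E"
  shows "e \<in> W"
proof -
  have "l e *\<^sub>R e \<in> W"
  proof (rule eigenvector_components_in_subspace[OF clinear_box W(1) W(3),
        where J = E and m = "\<lambda>e. (l e)\<^sup>2" and v = "\<lambda>e. l e *\<^sub>R e"])
    show "inj_on (\<lambda>e. (l e)\<^sup>2) E"
      using l inj by (intro inj_onI) (metis inj_onD less_imp_le power2_eq_imp_eq)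
    show "triple z z (l e *\<^sub>R e) = (l e)\<^sup>2 *\<^sub>R l e *\<^sub>R e" if "e \<in> E" for e
      unfolding z real_combination triple_scaleR_right box_combination_member[OF E that]
      by (simp add: scaleR_scaleC scaleC_scaleC power2_eq_square)
  qed (use W(2) z e orthogonal_tripotentsD(1)[OF E] in auto)
  then have "(1 / l e) *\<^sub>R l e *\<^sub>R e \<in> W"
    by (rule subspace_scale[OF W(1)])
  then show ?thesis
    using l[OF e] by simp
qed

lemma independent_tripotents:
  assumes E: "orthogonal_tripotents E"
  shows "\<not> cdependent E"
proof
  assume "cdependent E"
  then obtain u f where f: "f \<in> E" "u f \<noteq> 0" "(\<Sum>e\<in>E. u e *\<^sub>C e) = 0"
    using complex_vector.dependent_finite[OF orthogonal_tripotentsD(1)[OF E]] by auto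
  then show False
    using coefficient_le_norm[OF E f(1), of u] by simp
qed

lemma card_orthogonal_tripotents_le:
  assumes rank: "rank_le triple r" and E: "orthogonal_tripotents E"
  shows "card E \<le> r"
proof -
  note fin = orthogonal_tripotentsD(1)[OF E]
  obtain h where h: "bij_betw h E {0..<card E}"
    using ex_bij_betw_finite_nat[OF fin] by blast
  \<comment> \<open>Distinct weights make the subtriple generated by a single element contain all of \<open>E\<close>.\<close>
  define l where "l e = 1 + real (h e)" for e
  define z where "z = (\<Sum>e\<in>E. l e *\<^sub>R e)"
  obtain U S where U: "subtriple triple U" "z \<in> U" and S: "finite S" "card S \<le> r" "cspan S = U"
    using rank unfolding rank_le_def cdim_le_def by blast
  have "e \<in> U" if "e \<in> E" for e
  proof (rule combination_members_in_subspace[OF E _ _ z_def _ U(2) _ that])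
    show "inj_on l E"
      using h by (auto simp: l_def bij_betw_def inj_on_def)
  qed (use U in \<open>auto simp: l_def subtriple_def csubspace_imp_subspace\<close>)
  then show ?thesis
    using complex_vector.independent_span_bound[OF S(1) independent_tripotents[OF E]] S by fastforce
qed

definition maximal_tripotent :: "'a \<Rightarrow> bool"
  where "maximal_tripotent e \<longleftrightarrow> tripotent e \<and> (\<forall>z. triple e e z = 0 \<longrightarrow> z = 0)"

lemma exists_orthogonal_tripotent:
  assumes rank: "rank_le triple r" and s: "tripotent s" "\<not> maximal_tripotent s"
  shows "\<exists>f. tripotent f \<and> f \<noteq> 0 \<and> f \<in> peirce 0 s"
proof -
  obtain w where w: "triple s s w = 0" "w \<noteq> 0"
    using s by (auto simp: maximal_tripotent_def)
  obtain F l where F: "orthogonal_tripotents F" "\<forall>e\<in>F. 0 < l e" "inj_on l F" "w = (\<Sum>e\<in>F. l e *\<^sub>R e)"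
    using spectral_decomposition[OF rank] by blast
  have w0: "w \<in> peirce 0 s"
    using w by (simp add: peirce_zero_iff)
  obtain f where f: "f \<in> F"
    using w(2) F(4) by fastforce
  have "f \<in> peirce 0 s"
  proof (rule combination_members_in_subspace[OF F(1) _ F(3,4) _ w0 _ f])
    show "triple w w y \<in> peirce 0 s" if "y \<in> peirce 0 s" for y
      using peirce_triple[OF w0 w0 that] by simp
  qed (use F(2) in \<open>auto intro: csubspace_imp_subspace csubspace_peirce\<close>)
  then show ?thesis
    using f orthogonal_tripotentsD[OF F(1)] by blast
qed

lemma sum_tripotents_peirce_one:
  assumes "orthogonal_tripotents E" "e \<in> E"
  shows "e \<in> peirce 1 (\<Sum>E)"
  using box_combination_member[OF assms, of "\<lambda>_. 1" "\<lambda>_. 1"]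
  by (simp add: peirce_one_iff scaleC_one)

lemma orthogonal_tripotents_insert:
  assumes E: "orthogonal_tripotents E" and f: "tripotent f" "f \<noteq> 0" "f \<in> peirce 0 (\<Sum>E)"
  shows "orthogonal_tripotents (insert f E)" "f \<notin> E"
proof -
  have o: "ortho e f" if "e \<in> E" for e
    using ortho_peirce_one_zero[OF tripotent_sum[OF E] sum_tripotents_peirce_one[OF E that] f(3)] .
  then show "orthogonal_tripotents (insert f E)"
    using E f(1,2) ortho_commute by (auto simp: orthogonal_tripotents_def)
  show "f \<notin> E"
    using sum_tripotents_peirce_one[OF E] f by (auto simp: peirce_one_iff peirce_zero_iff)
qed

text \<open>Adding orthogonal tripotents one at a time ends, because the rank bounds their number.\<close>

lemma extend_to_maximal_tripotent:
  assumes rank: "rank_le triple r" and E: "orthogonal_tripotents E"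
  shows "\<exists>E'. E \<subseteq> E' \<and> orthogonal_tripotents E' \<and> maximal_tripotent (\<Sum>E')"
  using E
proof (induction "r - card E" arbitrary: E rule: less_induct)
  case less
  show ?case
  proof (cases "maximal_tripotent (\<Sum>E)")
    case False
    then obtain f where f: "tripotent f" "f \<noteq> 0" "f \<in> peirce 0 (\<Sum>E)"
      using exists_orthogonal_tripotent[OF rank tripotent_sum[OF less.prems]] by blast
    note E' = orthogonal_tripotents_insert[OF less.prems f]
    have "card (insert f E) = Suc (card E)"
      using E' orthogonal_tripotentsD(1)[OF less.prems] by simp
    then have "r - card (insert f E) < r - card E"
      using card_orthogonal_tripotents_le[OF rank E'(1)] by simp
    then show ?thesis
      using less.hyps[OF _ E'(1)] by blast
  qed (use less.prems in blast)
qed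


section \<open>Primitive tripotents\<close>

definition primitive_tripotent :: "'a \<Rightarrow> bool"
  where "primitive_tripotent e \<longleftrightarrow> tripotent e \<and> e \<noteq> 0 \<and>
    (\<forall>p q. tripotent p \<and> tripotent q \<and> ortho p q \<and> e = p + q \<longrightarrow> p = 0 \<or> q = 0)"

text \<open>The self-adjoint part of the Jordan algebra \<open>Z\<^sub>1(e)\<close>, whose product is \<open>{b,e,c}\<close> and whose
  involution is \<open>b \<mapsto> {e,b,e}\<close>.\<close>

definition self_adjoint :: "'a \<Rightarrow> 'a set"
  where "self_adjoint e = {x. triple e e x = x \<and> triple e x e = x}"

lemma subspace_self_adjoint: "subspace (self_adjoint e)"
  by (simp add: subspace_def self_adjoint_def triple_linear)

text \<open>Compare the Jordan identities for \<open>{b,e,{e,c,e}}\<close> and \<open>{b,c,{e,e,e}}\<close>.\<close>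

lemma self_adjoint_product:
  assumes e: "tripotent e" and b: "b \<in> self_adjoint e" and c: "c \<in> self_adjoint e"
  shows "triple b e c = triple b c e" "triple c b e = triple b c e" "triple b c e \<in> self_adjoint e"
proof -
  have 1: "triple b e c = triple b c e" "triple e (triple c b e) e = triple b c e" "triple e e (triple b c e) = triple b c e"
    if b: "b \<in> self_adjoint e" and c: "c \<in> self_adjoint e" for b c
  proof -
    have eb: "triple b e e = b"
      using b triple_commute[of b e e] by (simp add: self_adjoint_def)
    have "b \<in> peirce 1 e" "c \<in> peirce 1 e" "e \<in> peirce 1 e"
      using b c e by (simp_all add: self_adjoint_def peirce_def tripotent_def)
    then show m: "triple e e (triple b c e) = triple b c e"
      using peirce_triple[of b 1 e c 1 e 1] by (simp add: peirce_def)
    have "triple b c (triple e e e) =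
        triple (triple b c e) e e - triple e (triple c b e) e + triple e e (triple b c e)"
      by (rule jordan_identity)
    then show *: "triple e (triple c b e) e = triple b c e"
      using e m triple_commute[of "triple b c e" e e] by (simp add: tripotent_def)
    have "triple b e (triple e c e) =
        triple (triple b e e) c e - triple e (triple e b c) e + triple e c (triple b e e)"
      by (rule jordan_identity)
    then show "triple b e c = triple b c e"
      using c eb * triple_commute[of e b c] triple_commute[of e c b] by (simp add: self_adjoint_def)
  qed
  show "triple b e c = triple b c e"
    by (rule 1(1)[OF b c])
  show sym: "triple c b e = triple b c e"
    using 1(1)[OF b c] 1(1)[OF c b] triple_commute[of b e c] by simp
  show "triple b c e \<in> self_adjoint e"
    using 1(2,3)[OF b c] sym by (simp add: self_adjoint_def)
qed

text \<open>For self-adjoint \<open>x\<close> the operator \<open>x \<box> x\<close> is multiplication by the square \<open>{x,e,x}\<close>.\<close>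

lemma self_adjoint_box:
  assumes e: "tripotent e" and x: "x \<in> self_adjoint e" and y: "y \<in> self_adjoint e"
  shows "triple x x y \<in> self_adjoint e"
proof -
  let ?a = "triple x e x"
  have "triple x e (triple x e y) =
      triple (triple x e x) e y - triple x (triple e x e) y + triple x e (triple x e y)"
    by (rule jordan_identity)
  then have "triple x x y = triple ?a e y"
    using x by (simp add: self_adjoint_def)
  moreover have "?a \<in> self_adjoint e"
    using self_adjoint_product[OF e x x] by simp
  ultimately show ?thesis
    using self_adjoint_product[OF e _ y] by simp
qed

text \<open>Put \<open>f\<^sup>2 = {f,e,f}\<close>.  Then \<open>f\<^sup>2\<close> and \<open>e - f\<^sup>2\<close> lie in \<open>Z\<^sub>1(f)\<close> and \<open>Z\<^sub>0(f)\<close>, so they are orthogonal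
  tripotents with sum \<open>e\<close>, and \<open>f\<^sup>2 = e\<close> by primitivity.  Now \<open>(e + f)/2\<close> and \<open>(e - f)/2\<close> are
  orthogonal tripotents with sum \<open>e\<close>, and one of them vanishes.\<close>

lemma self_adjoint_tripotent_of_primitive:
  assumes prim: "primitive_tripotent e" and f: "f \<in> self_adjoint e" "tripotent f" "f \<noteq> 0"
  shows "f = e \<or> f = - e"
proof -
  have e: "tripotent e" "triple e e e = e"
    using prim by (simp_all add: primitive_tripotent_def tripotent_def)
  have f': "triple e e f = f" "triple e f e = f" "triple f f f = f" "triple f e e = f"
    using f triple_commute[of f e e] by (simp_all add: self_adjoint_def tripotent_def)
  define a where "a = triple f f e"
  have a: "triple f e f = a"
    using self_adjoint_product(1)[OF e(1) f(1) f(1)] by (simp add: a_def)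
  have a1: "a \<in> peirce 1 f"
    using box_Q_tripotent[OF f(2), of e] by (simp add: a peirce_one_iff)
  define q where "q = e - a"
  have q0: "q \<in> peirce 0 f"
    using a1 by (simp add: q_def peirce_def triple_diff_right flip: a_def)
  have aq: "ortho a q"
    by (rule ortho_peirce_one_zero[OF f(2) a1 q0])
  have eq: "e = a + q"
    by (simp add: q_def)
  have "triple a a q = 0" "triple q q a = 0"
    using aq triple_commute[of a a q] triple_commute[of q q a] by (simp_all add: ortho_def)
  then have "a + q = triple a a a + triple q q q"
    using e(2) aq unfolding eq by (simp add: ortho_def triple_linear)
  then have d: "a - triple a a a = triple q q q - q"
    by (simp add: algebra_simps)
  have "a - triple a a a \<in> peirce 1 f" "triple q q q - q \<in> peirce 0 f"
    using peirce_triple[OF a1 a1 a1] peirce_triple[OF q0 q0 q0] a1 q0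
    by (simp_all add: complex_vector.subspace_diff[OF csubspace_peirce])
  then have "a - triple a a a = 0"
    using d by (simp add: peirce_one_iff peirce_zero_iff)
  then have trip: "tripotent a" "tripotent q"
    using d by (simp_all add: tripotent_def)
  have "a \<noteq> 0"
  proof
    assume "a = 0"
    then have "ortho f e"
      using ortho_tripotentI[OF f(2)] by (simp add: a_def)
    then show False
      using f'(4) f(3) by (simp add: ortho_def)
  qed
  then have "q = 0"
    using prim trip aq eq by (auto simp: primitive_tripotent_def)
  then have "a = e"
    by (simp add: q_def)
  then have ea: "triple f f e = e" "triple f e f = e"
    using a by (simp_all add: a_def)
  have ea': "triple e f f = e"
    using triple_commute[of e f f] ea(1) by simp
  define g where "g = (1/2) *\<^sub>R (e + f)"
  define h where "h = (1/2) *\<^sub>R (e - f)"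
  have half: "(1/2) *\<^sub>R x + (1/2) *\<^sub>R x = x" for x :: 'a
    by (simp flip: scaleR_left_distrib)
  have gh: "e = g + h" "f = g - h"
    by (simp_all add: g_def h_def scaleR_right_diff_distrib scaleR_add_right half algebra_simps)
  have eighth: "(1/8) *\<^sub>R (x + x + x + x) = (1/2) *\<^sub>R x" for x :: 'a
    by (simp flip: scaleR_2 add: add.assoc)
  have "triple (e + f) (e + f) (e + f) = (e + f) + (e + f) + (e + f) + (e + f)"
    "triple (e - f) (e - f) (e - f) = (e - f) + (e - f) + (e - f) + (e - f)"
    by (simp_all add: triple_linear e(2) f' ea ea')
  then have "tripotent g" "tripotent h"
    by (simp_all add: g_def h_def tripotent_def triple_scaleR_left triple_scaleR_middle
        triple_scaleR_right eighth)
  moreover have "triple g g h = 0"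
    by (simp add: g_def h_def triple_linear e(2) f' ea ea')
  then have "ortho g h"
    using \<open>tripotent g\<close> by (rule ortho_tripotentI[rotated])
  ultimately have "g = 0 \<or> h = 0"
    using prim gh(1) by (auto simp: primitive_tripotent_def)
  then show ?thesis
    using gh by auto
qed

text \<open>The spectral tripotents of a self-adjoint element are self-adjoint, hence equal to \<open>e\<close> or \<open>- e\<close>;
  and \<open>Z\<^sub>1(e)\<close> is the complexification of its self-adjoint part.\<close>

lemma peirce_one_primitive:
  assumes rank: "rank_le triple r" and prim: "primitive_tripotent e" and z: "z \<in> peirce 1 e"
  shows "\<exists>c. z = c *\<^sub>C e"
proof -
  have e: "tripotent e"
    using prim by (simp add: primitive_tripotent_def)
  have real: "\<exists>t::real. x = t *\<^sub>R e" if x: "x \<in> self_adjoint e" for x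
  proof -
    obtain F l where F: "orthogonal_tripotents F" "\<forall>f\<in>F. 0 < l f" "inj_on l F" "x = (\<Sum>f\<in>F. l f *\<^sub>R f)"
      using spectral_decomposition[OF rank] by blast
    have "f \<in> self_adjoint e" if "f \<in> F" for f
      by (rule combination_members_in_subspace[OF F(1) _ F(3,4) subspace_self_adjoint x
            self_adjoint_box[OF e x] that]) (use F(2) in auto)
    then have "f = 1 *\<^sub>R e \<or> f = (-1) *\<^sub>R e" if "f \<in> F" for f
      using self_adjoint_tripotent_of_primitive[OF prim, of f] orthogonal_tripotentsD(2,3)[OF F(1) that] that
      by simp
    then have "\<exists>s::real. f = s *\<^sub>R e" if "f \<in> F" for f
      using that by blast
    then obtain s :: "'a \<Rightarrow> real" where s: "\<And>f. f \<in> F \<Longrightarrow> f = s f *\<^sub>R e"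
      by metis
    have "x = (\<Sum>f\<in>F. l f *\<^sub>R s f *\<^sub>R e)"
      unfolding F(4) by (intro sum.cong refl arg_cong[where f = "scaleR _"] s)
    then have "x = (\<Sum>f\<in>F. l f * s f) *\<^sub>R e"
      by (simp add: scaleR_sum_left)
    then show ?thesis
      by (rule exI)
  qed
  let ?z' = "triple e z e"
  have z1: "triple e e z = z"
    using z by (simp add: peirce_one_iff)
  have QQ: "triple e ?z' e = z"
    using Q_square_tripotent[OF e, of z] z1 by (simp add: scaleR_2)
  have z'1: "triple e e ?z' = ?z'"
    by (rule box_Q_tripotent[OF e])
  have "z + ?z' \<in> self_adjoint e" "\<i> *\<^sub>C (z - ?z') \<in> self_adjoint e"
    using z1 z'1 QQ
    by (simp_all add: self_adjoint_def triple_linear triple_scaleC_middle triple_scaleC_right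
        complex_vector.scale_right_diff_distrib)
  then obtain s t :: real where st: "z + ?z' = s *\<^sub>R e" "\<i> *\<^sub>C (z - ?z') = t *\<^sub>R e"
    using real by blast
  have "z - ?z' = (- \<i>) *\<^sub>C (\<i> *\<^sub>C (z - ?z'))"
    by (simp add: scaleC_scaleC scaleC_one)
  then have "z - ?z' = (- \<i> * complex_of_real t) *\<^sub>C e"
    by (simp only: st scaleR_scaleC scaleC_scaleC)
  then have "(z + ?z') + (z - ?z') = (complex_of_real s - \<i> * complex_of_real t) *\<^sub>C e"
    using st(1) by (simp add: scaleR_scaleC complex_vector.scale_left_diff_distrib)
  then have "2 *\<^sub>C z = (complex_of_real s - \<i> * complex_of_real t) *\<^sub>C e"
    using scaleC_add_left[of 1 1 z] by (simp add: scaleC_one)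
  then have "(1/2) *\<^sub>C 2 *\<^sub>C z = (1/2) *\<^sub>C (complex_of_real s - \<i> * complex_of_real t) *\<^sub>C e"
    by simp
  then have "z = ((complex_of_real s - \<i> * complex_of_real t) / 2) *\<^sub>C e"
    by (simp add: scaleC_scaleC scaleC_one)
  then show ?thesis
    by blast
qed

text \<open>Every spectral tripotent \<open>f\<close> of \<open>v\<close> lies in \<open>Z\<^sub>1\<^sub>/\<^sub>2(e)\<close>, so \<open>e\<close> is an eigenvector of \<open>f \<box> f\<close>;
  the eigenvalue is not \<open>0\<close>, since \<open>e\<close> and \<open>f\<close> are not orthogonal, so it is at least \<open>1/2\<close>.\<close>

lemma peirce_half_primitive:
  assumes rank: "rank_le triple r" and prim: "primitive_tripotent e" and v: "v \<in> peirce (1/2) e"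
  shows "\<exists>c. triple v v e = c *\<^sub>R e \<and> (norm v)\<^sup>2 \<le> 2 * c"
proof -
  have e: "tripotent e" "e \<noteq> 0" "e \<in> peirce 1 e"
    using prim by (simp_all add: primitive_tripotent_def peirce_one_iff tripotent_def)
  obtain F l where F: "orthogonal_tripotents F" "\<forall>f\<in>F. 0 < l f" "inj_on l F" "v = (\<Sum>f\<in>F. l f *\<^sub>R f)"
    using spectral_decomposition[OF rank] by blast
  have half: "f \<in> peirce (1/2) e" if "f \<in> F" for f
  proof (rule combination_members_in_subspace[OF F(1) _ F(3,4) _ v _ that])
    show "triple v v y \<in> peirce (1/2) e" if "y \<in> peirce (1/2) e" for y
      using peirce_triple[OF v v that] by simp
  qed (use F(2) in \<open>auto intro: csubspace_imp_subspace csubspace_peirce\<close>)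
  have "\<exists>k\<ge>1/2. triple f f e = k *\<^sub>R e" if f: "f \<in> F" for f
  proof -
    note tf = orthogonal_tripotentsD(2,3)[OF F(1) f]
    have "triple f f e \<in> peirce 1 e"
      using peirce_triple[OF half[OF f] half[OF f] e(3)] by simp
    then obtain c where c: "triple f f e = c *\<^sub>C e"
      using peirce_one_primitive[OF rank prim] by blast
    then obtain k where k: "c = complex_of_real k"
      using box_eigenvalue_nonneg[OF c e(2)] by blast
    have "e \<in> peirce k f"
      using c k by (simp add: peirce_def scaleR_scaleC)
    then have "k \<in> {0, 1/2, 1}"
      using peirce_eq_zero[OF tf(1)] e(2) by blast
    moreover have "k \<noteq> 0"
    proof
      assume "k = 0"
      then have "ortho f e"
        using c k by (intro ortho_tripotentI tf) simp
      then have "triple e e f = 0"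
        using triple_commute[of e e f] by (simp add: ortho_def)
      then show False
        using half[OF f] tf(2) by (simp add: peirce_def)
    qed
    ultimately show ?thesis
      using c k by (intro exI[of _ k]) (auto simp: scaleR_scaleC)
  qed
  then obtain k where k: "\<And>f. f \<in> F \<Longrightarrow> 1/2 \<le> k f" "\<And>f. f \<in> F \<Longrightarrow> triple f f e = k f *\<^sub>R e"
    by metis
  define c where "c = (\<Sum>f\<in>F. (l f)\<^sup>2 * k f)"
  have "triple v v e = (\<Sum>f\<in>F. ((l f)\<^sup>2 * k f) *\<^sub>R e)"
    unfolding F(4) real_combination box_combination[OF F(1)]
    by (intro sum.cong refl) (simp add: k scaleR_scaleC scaleC_scaleC power2_eq_square)
  then have vve: "triple v v e = c *\<^sub>R e"
    by (simp add: c_def scaleR_sum_left)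
  have "(norm v)\<^sup>2 \<le> 2 * c"
  proof (cases "F = {}")
    case False
    note fin = orthogonal_tripotentsD(1)[OF F(1)]
    have l: "(l f)\<^sup>2 \<le> 2 * c" if "f \<in> F" for f
    proof -
      have "(l f)\<^sup>2 * (1/2) \<le> (l f)\<^sup>2 * k f"
        using k(1)[OF that] by (intro mult_left_mono) auto
      also have "\<dots> \<le> c"
        unfolding c_def using fin that k(1) by (intro member_le_sum) (force intro!: mult_nonneg_nonneg)+
      finally show ?thesis
        by simp
    qed
    then have pos: "0 < c"
      using False F(2) by (metis all_not_in_conv less_le_trans zero_less_mult_iff zero_less_numeral zero_less_power less_asym)
    have "norm v \<le> sqrt (2 * c)"
      unfolding F(4) real_combination
      using l F(2) pos by (intro norm_combination_le[OF F(1)]) (auto simp: real_le_rsqrt)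
    then show ?thesis
      using pos real_sqrt_le_iff by (metis less_imp_le mult_nonneg_nonneg norm_ge_zero power_mono real_sqrt_pow2 zero_le_numeral)
  qed (use F(4) in \<open>simp add: c_def\<close>)
  with vve show ?thesis
    by blast
qed

text \<open>Compare the \<open>Z\<^sub>1\<close>-part of \<open>{z,z,e}\<close>, of norm at most \<open>1\<close>, with its value
  \<open>(\<bar>k\<bar>\<^sup>2 + c) e\<close>, where \<open>z = k e + v + w\<close>, \<open>{v,v,e} = c e\<close> and \<open>2 c \<ge> \<parallel>v\<parallel>\<^sup>2\<close>.\<close>

lemma primitive_norm_estimate:
  assumes rank: "rank_le triple r" and prim: "primitive_tripotent e"
    and v: "v \<in> peirce (1/2) e" and w: "w \<in> peirce 0 e" and le1: "norm (k *\<^sub>C e + v + w) \<le> 1"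
  shows "(cmod k)\<^sup>2 + (norm v)\<^sup>2 / 2 \<le> 1"
proof -
  have e: "tripotent e" "e \<noteq> 0" "e \<in> peirce 1 e" "triple e e e = e"
    using prim by (simp_all add: primitive_tripotent_def peirce_one_iff tripotent_def)
  let ?a = "k *\<^sub>C e"
  have a: "?a \<in> peirce 1 e"
    using e(3) by (simp add: complex_vector.subspace_scale csubspace_peirce)
  obtain c where c: "triple v v e = c *\<^sub>R e" "(norm v)\<^sup>2 \<le> 2 * c"
    using peirce_half_primitive[OF rank prim v] by blast
  have 0: "triple ?a v e = 0" "triple ?a w e = 0" "triple v w e = 0"
    using peirce_triple_eq_zero[OF e(1) a v e(3)] peirce_triple_eq_zero[OF e(1) a w e(3)]
      peirce_triple_eq_zero[OF e(1) v w e(3)] by simp_all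
  have "ortho e w"
    by (rule ortho_peirce_one_zero[OF e(1,3) w])
  then have 00: "triple w w e = 0"
    using triple_commute[of w w e] by (simp add: ortho_def)
  let ?z = "?a + v + w"
  have zze: "triple ?z ?z e =
      (triple ?a ?a e + triple v v e) + (triple v ?a e + triple w v e) + triple w ?a e"
    by (simp add: triple_add_left triple_add_middle 0 00 algebra_simps)
  have "norm (triple ?a ?a e + triple v v e) \<le> norm (triple ?z ?z e)"
    unfolding zze
  proof (rule norm_peirce_one_le)
    show "triple ?a ?a e + triple v v e \<in> peirce 1 e"
      using peirce_triple[OF a a e(3)] peirce_triple[OF v v e(3)]
      by (simp add: complex_vector.subspace_add[OF csubspace_peirce])
    show "triple v ?a e + triple w v e \<in> peirce (1/2) e"
      using peirce_triple[OF v a e(3)] peirce_triple[OF w v e(3)]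
      by (simp add: complex_vector.subspace_add[OF csubspace_peirce])
    show "triple w ?a e \<in> peirce 0 e"
      using peirce_triple[OF w a e(3)] by simp
  qed
  also have "\<dots> \<le> (norm ?z)\<^sup>2 * norm e"
    by (rule norm_triple_le)
  also have "\<dots> \<le> 1"
    using le1 norm_tripotent_eq_1[OF e(1,2)] by (simp add: power_le_one)
  also have "triple ?a ?a e = (cmod k)\<^sup>2 *\<^sub>R e"
    unfolding triple_scaleC_left triple_scaleC_middle scaleC_scaleC e(4) scaleR_scaleC
      complex_norm_square by (simp only: mult.commute)
  also have "(cmod k)\<^sup>2 *\<^sub>R e + triple v v e = ((cmod k)\<^sup>2 + c) *\<^sub>R e"
    by (simp add: c(1) scaleR_left_distrib)
  finally have "\<bar>(cmod k)\<^sup>2 + c\<bar> \<le> 1"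
    using norm_tripotent_eq_1[OF e(1,2)] by simp
  then show ?thesis
    using c(2) by simp
qed

text \<open>Splitting \<open>f = p + q\<close> keeps the system orthogonal, since \<open>p\<close> and \<open>q\<close> lie in \<open>Z\<^sub>1(f)\<close> and the
  other members in \<open>Z\<^sub>0(f)\<close>; the rank bounds the number of splittings.\<close>

lemma primitive_decomposition:
  assumes rank: "rank_le triple r" and E: "orthogonal_tripotents E"
  shows "\<exists>E'. orthogonal_tripotents E' \<and> \<Sum>E' = \<Sum>E \<and> (\<forall>f\<in>E'. primitive_tripotent f)"
  using E
proof (induction "r - card E" arbitrary: E rule: less_induct)
  case less
  note E = less.prems
  show ?case
  proof (cases "\<forall>f\<in>E. primitive_tripotent f")
    case False
    then obtain f p q where f: "f \<in> E" and pq: "tripotent p" "tripotent q" "ortho p q" "f = p + q" "p \<noteq> 0" "q \<noteq> 0"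
      using orthogonal_tripotentsD(2,3)[OF E] by (auto simp: primitive_tripotent_def)
    have tf: "tripotent f"
      using orthogonal_tripotentsD(2)[OF E f] .
    have "triple q q p = 0" "triple p p q = 0"
      using pq(3) triple_commute[of q q p] triple_commute[of p p q] by (simp_all add: ortho_def)
    then have p1: "p \<in> peirce 1 f" "q \<in> peirce 1 f"
      using pq(1-3) by (simp_all add: peirce_one_iff pq(4) triple_add_left triple_add_middle ortho_def tripotent_def)
    have "g \<in> peirce 0 f" if "g \<in> E - {f}" for g
      using box_member[OF E f, of g] that by (auto simp: peirce_zero_iff)
    then have o: "ortho p g" "ortho q g" if "g \<in> E - {f}" for g
      using ortho_peirce_one_zero[OF tf] p1 that by blast+
    have oself: "x = 0" if "ortho x x" for x
      using that cube_eq_zero_iff[of x] by (simp add: ortho_def)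
    let ?E = "insert p (insert q (E - {f}))"
    have new: "p \<notin> insert q (E - {f})" "q \<notin> E - {f}"
      using o oself pq by blast+
    have "orthogonal_tripotents ?E"
      using E pq o ortho_commute by (auto simp: orthogonal_tripotents_def)
    note E' = this
    have fin: "finite E"
      by (rule orthogonal_tripotentsD(1)[OF E])
    have "card ?E = Suc (Suc (card (E - {f})))"
      using new fin by simp
    then have "card ?E = Suc (card E)"
      using card.remove[OF fin f] by simp
    then have less_card: "r - card ?E < r - card E"
      using card_orthogonal_tripotents_le[OF rank E'] by simp
    have "\<Sum>?E = p + (q + \<Sum>(E - {f}))"
      using new fin by simp
    also have "\<dots> = f + \<Sum>(E - {f})"
      by (simp only: pq(4) add.assoc)
    also have "\<dots> = \<Sum>E"
      using fin f by (simp only: sum.remove)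
    finally have "\<Sum>?E = \<Sum>E" .
    then show ?thesis
      using less.hyps[OF less_card E'] by simp
  qed (use less.prems in blast)
qed

section \<open>Maximal tripotents are strongly exposed\<close>

lemma complex_functional_iff:
  "Vector_Spaces.linear scaleC (*) (\<phi> :: 'a \<Rightarrow> complex) \<longleftrightarrow>
    (\<forall>x y. \<phi> (x + y) = \<phi> x + \<phi> y) \<and> (\<forall>c x. \<phi> (c *\<^sub>C x) = c * \<phi> x)"
proof -
  have "vector_space ((*) :: complex \<Rightarrow> complex \<Rightarrow> complex)"
    by unfold_locales (simp_all add: algebra_simps)
  then show ?thesis
    by (simp add: Vector_Spaces.linear_iff complex_vector.vector_space_axioms)
qed

lemma primitive_functional:
  assumes rank: "rank_le triple r" and prim: "primitive_tripotent e"
  shows "\<exists>\<phi>. Vector_Spaces.linear scaleC (*) \<phi> \<and> (\<forall>z. peirce_proj1 e z = \<phi> z *\<^sub>C e)"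
proof -
  have e: "tripotent e" "e \<noteq> 0"
    using prim by (simp_all add: primitive_tripotent_def)
  have "\<exists>c. peirce_proj1 e z = c *\<^sub>C e" for z
    using peirce_one_primitive[OF rank prim peirce_proj_mem(1)[OF e(1)]] .
  then obtain \<phi> where \<phi>: "\<And>z. peirce_proj1 e z = \<phi> z *\<^sub>C e"
    by metis
  have eq: "a = b" if "a *\<^sub>C e = b *\<^sub>C e" for a b
    using that e(2) by (simp add: complex_vector.scale_cancel_right)
  have "\<phi> (x + y) = \<phi> x + \<phi> y" for x y
    by (rule eq) (simp add: scaleC_add_left clinear_add[OF clinear_peirce_proj1] flip: \<phi>)
  moreover have "\<phi> (c *\<^sub>C x) = c * \<phi> x" for c x
    by (rule eq) (simp add: clinear_scaleC[OF clinear_peirce_proj1] flip: \<phi> scaleC_scaleC)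
  ultimately show ?thesis
    using \<phi> by (auto simp: complex_functional_iff)
qed

text \<open>The functional is the sum of the coordinates along a decomposition of \<open>e\<close> into primitive
  tripotents.  When all coordinates of \<open>z\<close> are nearly \<open>1\<close>, the estimate for a single primitive
  tripotent makes \<open>(e \<box> e) z\<close> nearly equal to \<open>e = (e \<box> e) e\<close>, and \<open>e \<box> e\<close>, whose eigenvalues are
  \<open>1/2\<close> and \<open>1\<close>, has the inverse \<open>3 - 2 (e \<box> e)\<close> of norm at most \<open>5\<close>.  The remaining factor \<open>3\<close>
  bounds the contribution of one primitive tripotent.\<close>

lemma maximal_tripotent_strongly_exposed:
  assumes rank: "rank_le triple r" and max: "maximal_tripotent e"
  shows "\<exists>(\<phi> :: 'a \<Rightarrow> complex) (n :: nat). Vector_Spaces.linear scaleC (*) \<phi> \<and> bounded_linear \<phi> \<and> \<phi> e = of_nat n \<and>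
    (\<forall>z. norm z \<le> 1 \<longrightarrow> Re (\<phi> z) \<le> n \<and> norm (z - e) \<le> 15 * n * sqrt (n - Re (\<phi> z)))"
proof -
  have e: "tripotent e" "triple e e e = e"
    using max by (simp_all add: maximal_tripotent_def tripotent_def)
  \<comment> \<open>On the zero space \<open>e = 0\<close>; then the system is empty and \<open>n = 0\<close>.\<close>
  have "orthogonal_tripotents ({e} - {0})"
    using e by (auto simp: orthogonal_tripotents_def)
  then obtain E where E: "orthogonal_tripotents E" "\<Sum>E = \<Sum>({e} - {0})" "\<forall>f\<in>E. primitive_tripotent f"
    using primitive_decomposition[OF rank] by blast
  have esum: "e = \<Sum>E"
    using E(2) by (cases "e = 0") auto
  note fin = orthogonal_tripotentsD(1)[OF E(1)]
  obtain \<phi> where \<phi>: "\<And>f. f \<in> E \<Longrightarrow> Vector_Spaces.linear scaleC (*) (\<phi> f)"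
      "\<And>f z. f \<in> E \<Longrightarrow> peirce_proj1 f z = \<phi> f z *\<^sub>C f"
    using primitive_functional[OF rank] E(3) by metis
  define \<Phi> where "\<Phi> z = (\<Sum>f\<in>E. \<phi> f z)" for z
  let ?n = "card E"
  have est: "(cmod (\<phi> f z))\<^sup>2 + (norm (peirce_proj_half f z))\<^sup>2 / 2 \<le> 1" if "f \<in> E" "norm z \<le> 1" for f z
  proof -
    have "tripotent f"
      using orthogonal_tripotentsD(2)[OF E(1) that(1)] .
    then show ?thesis
      using primitive_norm_estimate[OF rank, of f "peirce_proj_half f z" "peirce_proj0 f z" "\<phi> f z"]
        E(3) that peirce_proj_mem(2,3)[of f z] peirce_decomposition[of z f] by (simp flip: \<phi>(2))
  qed
  have bound: "cmod (\<phi> f z) \<le> norm z" if f: "f \<in> E" for f z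
  proof -
    have tf: "tripotent f" "f \<noteq> 0"
      using orthogonal_tripotentsD(2,3)[OF E(1) f] .
    have "norm (\<phi> f z *\<^sub>C f) \<le> norm z"
      using norm_peirce_one_le[OF peirce_proj_mem[OF tf(1), of z]] peirce_decomposition[of z f] \<phi>(2)[OF f]
      by simp
    then show ?thesis
      using norm_tripotent_eq_1[OF tf] by (simp add: norm_scaleC)
  qed
  have lin: "Vector_Spaces.linear scaleC (*) \<Phi>"
    using \<phi>(1) by (simp add: complex_functional_iff \<Phi>_def sum.distrib sum_distrib_left)
  moreover have "bounded_linear \<Phi>"
  proof (rule bounded_linear_intro[where K = "real ?n"])
    show "norm (\<Phi> z) \<le> norm z * real ?n" for z
      using sum_norm_bound[of E "\<lambda>f. \<phi> f z" "norm z"] bound by (simp add: \<Phi>_def mult.commute)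
  qed (use lin in \<open>simp_all add: complex_functional_iff scaleR_scaleC scaleR_conv_of_real\<close>)
  moreover have "\<Phi> e = of_nat ?n"
  proof -
    have "\<phi> f e = 1" if f: "f \<in> E" for f
    proof -
      have "triple f f e = (\<Sum>g\<in>E. if f = g then g else 0)"
        unfolding esum triple_sum_right using box_member[OF E(1) f] by (intro sum.cong) auto
      then have "triple f f e = f"
        using f fin by simp
      then have "peirce_proj1 f e = f"
        using orthogonal_tripotentsD(2)[OF E(1) f] by (simp add: peirce_proj1_def tripotent_def scaleR_2)
      then have "\<phi> f e *\<^sub>C f = 1 *\<^sub>C f"
        using \<phi>(2)[OF f, of e] by (simp add: scaleC_one)
      then show ?thesis
        using orthogonal_tripotentsD(3)[OF E(1) f] complex_vector.scale_cancel_right[of "\<phi> f e" f 1]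
        by simp
    qed
    then show ?thesis
      by (simp add: \<Phi>_def)
  qed
  moreover have "Re (\<Phi> z) \<le> ?n \<and> norm (z - e) \<le> 15 * ?n * sqrt (?n - Re (\<Phi> z))" if z: "norm z \<le> 1" for z
  proof -
    define S where "S = ?n - Re (\<Phi> z)"
    have S: "S = (\<Sum>f\<in>E. 1 - Re (\<phi> f z))"
      by (simp add: S_def \<Phi>_def sum_subtractf)
    have nonneg: "0 \<le> 1 - Re (\<phi> f z)" if "f \<in> E" for f
      using bound[OF that, of z] complex_Re_le_cmod[of "\<phi> f z"] z by linarith
    have le_S: "1 - Re (\<phi> f z) \<le> S" if "f \<in> E" for f
      unfolding S using that nonneg fin by (intro member_le_sum) auto
    have S0: "0 \<le> S"
      unfolding S using nonneg by (rule sum_nonneg)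
    have near: "norm (triple f f z - f) \<le> 3 * sqrt S" if f: "f \<in> E" for f
    proof -
      have tf: "tripotent f" "norm f = 1"
        using orthogonal_tripotentsD(2,3)[OF E(1) f] norm_tripotent_eq_1 by blast+
      define v where "v = peirce_proj_half f z"
      define a where "a = \<phi> f z"
      have sq: "(cmod a)\<^sup>2 = (Re a)\<^sup>2 + (Im a)\<^sup>2"
        by (rule cmod_power2)
      have "1 - (Re a)\<^sup>2 \<le> 2 * (1 - Re a)"
        using zero_le_power2[of "1 - Re a"] by (simp add: power2_eq_square algebra_simps)
      moreover have "(Re a)\<^sup>2 \<le> (cmod a)\<^sup>2"
        by (simp add: sq)
      moreover have "(cmod a)\<^sup>2 + (norm v)\<^sup>2 / 2 \<le> 1"
        using est[OF f z] by (simp add: a_def v_def)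
      ultimately have "(norm v)\<^sup>2 \<le> 4 * S"
        using le_S[OF f] by (simp add: a_def)
      then have v: "norm v \<le> 2 * sqrt S"
        using real_le_rsqrt[of "norm v" "4 * S"] by (simp add: real_sqrt_mult)
      have "(cmod (a - 1))\<^sup>2 = (cmod a)\<^sup>2 + 1 - 2 * Re a"
        unfolding cmod_power2 by (simp add: power2_eq_square algebra_simps)
      moreover have "(cmod a)\<^sup>2 \<le> 1"
        using bound[OF f, of z] z by (simp add: a_def power_le_one)
      ultimately have "(cmod (a - 1))\<^sup>2 \<le> 4 * S"
        using le_S[OF f] S0 by (simp add: a_def)
      then have a: "cmod (a - 1) \<le> 2 * sqrt S"
        using real_le_rsqrt[of "cmod (a - 1)" "4 * S"] by (simp add: real_sqrt_mult)
      have "triple f f z = peirce_proj1 f z + (1/2) *\<^sub>R v"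
        by (subst peirce_decomposition[of z f])
          (use peirce_proj_mem[OF tf(1), of z] in \<open>simp add: triple_add_right peirce_def v_def\<close>)
      then have "triple f f z - f = (a - 1) *\<^sub>C f + (1/2) *\<^sub>R v"
        by (simp add: \<phi>(2)[OF f] a_def complex_vector.scale_left_diff_distrib scaleC_one)
      then have "norm (triple f f z - f) \<le> cmod (a - 1) + norm v / 2"
        using norm_triangle_ineq[of "(a - 1) *\<^sub>C f" "(1/2) *\<^sub>R v"] tf(2) by (simp add: norm_scaleC)
      then show ?thesis
        using a v by linarith
    qed
    have "triple e e z - e = (\<Sum>f\<in>E. triple f f z - f)"
      by (simp add: esum box_sum_tripotents[OF E(1)] sum_subtractf)
    then have "norm (triple e e z - e) \<le> ?n * (3 * sqrt S)"
      using sum_norm_bound[of E "\<lambda>f. triple f f z - f" "3 * sqrt S"] near by simp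
    moreover have "triple e e z - e = triple e e (z - e)"
      by (simp add: triple_diff_right e(2))
    moreover have "norm (z - e) \<le> 5 * norm (triple e e (z - e))"
    proof -
      let ?w = "z - e"
      have "peirce_proj0 e ?w = 0"
        using max peirce_proj_mem(3)[OF e(1), of ?w] by (auto simp: maximal_tripotent_def peirce_zero_iff)
      then have "?w = 3 *\<^sub>R triple e e ?w - 2 *\<^sub>R triple e e (triple e e ?w)"
        by (simp add: peirce_proj0_def algebra_simps)
      then have "norm ?w \<le> norm (3 *\<^sub>R triple e e ?w) + norm (2 *\<^sub>R triple e e (triple e e ?w))"
        by (metis norm_triangle_ineq4)
      then show ?thesis
        using norm_box_tripotent_le[OF e(1), of "triple e e ?w"] by simp
    qed
    ultimately show ?thesis
      using S0 by (simp add: S_def)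
  qed
  ultimately show ?thesis
    by blast
qed


section \<open>Extreme points of the unit ball\<close>

lemma maximal_tripotent_extreme:
  assumes rank: "rank_le triple r" and max: "maximal_tripotent e"
  shows "e extreme_point_of cball 0 1"
proof -
  obtain \<phi> :: "'a \<Rightarrow> complex" and n :: nat where \<phi>: "bounded_linear \<phi>" "\<phi> e = of_nat n"
    and peak: "\<And>z. norm z \<le> 1 \<Longrightarrow> Re (\<phi> z) \<le> n \<and> norm (z - e) \<le> 15 * n * sqrt (n - Re (\<phi> z))"
    using maximal_tripotent_strongly_exposed[OF rank max] by blast
  have "e \<notin> open_segment a b" if ab: "norm a \<le> 1" "norm b \<le> 1" for a b
  proof
    assume "e \<in> open_segment a b"
    then obtain u where u: "a \<noteq> b" "0 < u" "u < 1" "e = (1 - u) *\<^sub>R a + u *\<^sub>R b"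
      by (auto simp: in_segment)
    have "real n = Re (\<phi> e)"
      using \<phi>(2) by simp
    also have "\<dots> = (1 - u) * Re (\<phi> a) + u * Re (\<phi> b)"
      by (simp add: u(4) linear_simps[OF \<phi>(1)])
    finally have "(1 - u) * (n - Re (\<phi> a)) + u * (n - Re (\<phi> b)) = 0"
      by (simp add: algebra_simps)
    moreover have "0 \<le> (1 - u) * (n - Re (\<phi> a))" "0 \<le> u * (n - Re (\<phi> b))"
      using peak[OF ab(1)] peak[OF ab(2)] u by simp_all
    ultimately have "(1 - u) * (n - Re (\<phi> a)) = 0" "u * (n - Re (\<phi> b)) = 0"
      by linarith+
    then have "Re (\<phi> a) = n" "Re (\<phi> b) = n"
      using u by simp_all
    then have "norm (a - e) \<le> 0" "norm (b - e) \<le> 0"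
      using peak[OF ab(1)] peak[OF ab(2)] by simp_all
    then show False
      using u(1) by simp
  qed
  then show ?thesis
    using norm_tripotent_le_1 max by (auto simp: extreme_point_of_def maximal_tripotent_def)
qed

lemma extreme_point_perturbation:
  fixes e d :: "'b::real_normed_vector"
  assumes "e extreme_point_of cball 0 1" "norm (e + d) \<le> 1" "norm (e - d) \<le> 1"
  shows "d = 0"
proof (rule ccontr)
  assume "d \<noteq> 0"
  have "e + d \<noteq> e - d"
  proof
    assume "e + d = e - d"
    then have "2 *\<^sub>R d = 0"
      by (simp add: scaleR_2 algebra_simps)
    then show False
      using \<open>d \<noteq> 0\<close> by simp
  qed
  moreover have "e = (1 - 1/2) *\<^sub>R (e + d) + (1/2) *\<^sub>R (e - d)"
    by (simp add: scaleR_add_right scaleR_diff_right flip: scaleR_left_distrib)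
  ultimately have "e \<in> open_segment (e + d) (e - d)"
    by (auto simp: in_segment intro!: exI[of _ "1/2"])
  then show False
    using assms by (auto simp: extreme_point_of_def)
qed

text \<open>A spectral coefficient below \<open>1\<close>, or a tripotent orthogonal to \<open>e\<close>, gives room to move from
  \<open>e\<close> in two opposite directions.\<close>

lemma extreme_imp_maximal_tripotent:
  assumes rank: "rank_le triple r" and ext: "e extreme_point_of cball 0 1"
  shows "maximal_tripotent e"
proof -
  have norm_e: "norm e \<le> 1"
    using ext by (auto simp: extreme_point_of_def)
  obtain E l where E: "orthogonal_tripotents E" "\<forall>f\<in>E. 0 < l f" "inj_on l E" "e = (\<Sum>f\<in>E. l f *\<^sub>R f)"
    using spectral_decomposition[OF rank] by blast
  note fin = orthogonal_tripotentsD(1)[OF E(1)]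
  have le1: "l f \<le> 1" if "f \<in> E" for f
  proof -
    have "cmod (complex_of_real (l f)) \<le> norm e"
      unfolding E(4) real_combination by (rule coefficient_le_norm[OF E(1) that])
    then show ?thesis
      using norm_e by simp
  qed
  have perturb: "norm (e + a *\<^sub>R f) \<le> 1" if f: "f \<in> E" and a: "\<bar>l f + a\<bar> \<le> 1" for f a
  proof -
    have "e + a *\<^sub>R f = (\<Sum>g\<in>E. (l(f := l f + a)) g *\<^sub>R g)"
    proof -
      have "(\<Sum>g\<in>E - {f}. (l(f := l f + a)) g *\<^sub>R g) = (\<Sum>g\<in>E - {f}. l g *\<^sub>R g)"
        by (intro sum.cong) auto
      then show ?thesis
        unfolding E(4) sum.remove[OF fin f] by (simp add: scaleR_left_distrib)
    qed
    also have "norm \<dots> \<le> 1"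
      unfolding real_combination using le1 E(2) a
      by (intro norm_combination_le_1[OF E(1)]) (auto simp: abs_of_pos simp del: of_real_add)
    finally show ?thesis .
  qed
  have "l f = 1" if f: "f \<in> E" for f
  proof -
    have "(1 - l f) *\<^sub>R f = 0"
      using perturb[OF f, of "1 - l f"] perturb[OF f, of "- (1 - l f)"] le1[OF f] E(2) f
      by (intro extreme_point_perturbation[OF ext]) (auto simp: algebra_simps)
    then show ?thesis
      using orthogonal_tripotentsD(3)[OF E(1) f] by simp
  qed
  then have e: "e = \<Sum>E"
    unfolding E(4) by (intro sum.cong) auto
  show ?thesis
  proof (rule ccontr)
    assume "\<not> maximal_tripotent e"
    then obtain f where f: "tripotent f" "f \<noteq> 0" "f \<in> peirce 0 (\<Sum>E)"
      using exists_orthogonal_tripotent[OF rank] tripotent_sum[OF E(1)] e by blast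
    note E' = orthogonal_tripotents_insert[OF E(1) f]
    have "norm (e + c *\<^sub>C f) \<le> 1" if "cmod c = 1" for c
    proof -
      have "(\<Sum>g\<in>E. (if g = f then c else 1) *\<^sub>C g) = \<Sum>E"
        using E'(2) by (intro sum.cong refl) (auto simp: scaleC_one)
      then have "(\<Sum>g\<in>insert f E. (if g = f then c else 1) *\<^sub>C g) = c *\<^sub>C f + e"
        using E'(2) fin by (simp add: e)
      moreover have "norm (\<Sum>g\<in>insert f E. (if g = f then c else 1) *\<^sub>C g) \<le> 1"
        using that by (intro norm_combination_le_1[OF E'(1)]) auto
      ultimately show ?thesis
        by (simp add: add.commute)
    qed
    from this[of 1] this[of "-1"] have "f = 0"
      by (intro extreme_point_perturbation[OF ext]) (simp_all add: scaleC_one scaleC_minus1_left)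
    then show False
      using f(2) by simp
  qed
qed

lemma extreme_points_eq_maximal_tripotents:
  assumes "rank_le triple r"
  shows "{e. e extreme_point_of cball 0 1} = {e. maximal_tripotent e}"
  using maximal_tripotent_extreme[OF assms] extreme_imp_maximal_tripotent[OF assms] by blast

text \<open>Polarisation, after normalising \<open>a\<close> and \<open>b\<close>, turns the norm axiom into continuity of
  \<open>e \<mapsto> e \<box> e\<close>.\<close>

lemma norm_symmetrised_box_le:
  "norm (triple a b z + triple b a z) \<le> 4 * norm a * norm b * norm z"
proof -
  have unit: "norm (triple a b z + triple b a z) \<le> 4 * norm z" if ab: "norm a \<le> 1" "norm b \<le> 1" for a b
  proof -
    have "2 *\<^sub>R (triple a b z + triple b a z) = triple (a + b) (a + b) z - triple (a - b) (a - b) z"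
      by (simp add: triple_linear scaleR_2)
    then have "2 * norm (triple a b z + triple b a z) =
        norm (triple (a + b) (a + b) z - triple (a - b) (a - b) z)"
      by (metis norm_scaleR abs_numeral)
    also have "\<dots> \<le> (norm (a + b))\<^sup>2 * norm z + (norm (a - b))\<^sup>2 * norm z"
      by (intro order_trans[OF norm_triangle_ineq4] add_mono norm_triple_le)
    also have "\<dots> \<le> 2\<^sup>2 * norm z + 2\<^sup>2 * norm z"
      using ab norm_triangle_ineq[of a b] norm_triangle_ineq4[of a b]
      by (intro add_mono mult_right_mono power_mono) auto
    finally show ?thesis
      by simp
  qed
  have sgn: "norm x *\<^sub>R sgn x = x" for x :: 'a
    by (cases "x = 0") (simp_all add: sgn_div_norm)
  have "triple a b z + triple b a z =
      triple (norm a *\<^sub>R sgn a) (norm b *\<^sub>R sgn b) z + triple (norm b *\<^sub>R sgn b) (norm a *\<^sub>R sgn a) z"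
    by (simp only: sgn)
  also have "\<dots> = (norm a * norm b) *\<^sub>R (triple (sgn a) (sgn b) z + triple (sgn b) (sgn a) z)"
    by (simp add: triple_scaleR_left triple_scaleR_middle scaleR_add_right mult.commute)
  finally have "norm (triple a b z + triple b a z) \<le> (norm a * norm b) * (4 * norm z)"
    using unit[of "sgn a" "sgn b"] by (simp add: norm_sgn mult_left_mono)
  then show ?thesis
    by (simp add: mult_ac)
qed

lemma continuous_on_box:
  assumes g: "continuous_on UNIV g"
  shows "continuous_on UNIV (\<lambda>e. triple e e (g e))"
  unfolding continuous_on_def
proof
  fix s :: 'a
  have gs: "(g \<longlongrightarrow> g s) (at s)"
    using g by (simp add: continuous_on_def)
  have bound: "norm (triple e e (g e) - triple s s (g s)) \<le>
      (norm e)\<^sup>2 * norm (g e - g s) + 2 * norm (e + s) * norm (e - s) * norm (g s)" for e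
  proof -
    let ?d = "triple (e + s) (e - s) (g s) + triple (e - s) (e + s) (g s)"
    have "2 *\<^sub>R (triple e e (g s) - triple s s (g s)) = ?d"
      by (simp add: triple_linear scaleR_2)
    then have "2 * norm (triple e e (g s) - triple s s (g s)) = norm ?d"
      by (metis norm_scaleR abs_numeral)
    then have 1: "norm (triple e e (g s) - triple s s (g s)) \<le>
        2 * norm (e + s) * norm (e - s) * norm (g s)"
      using norm_symmetrised_box_le[of "e + s" "e - s" "g s"] by simp
    have "triple e e (g e) - triple s s (g s) =
        triple e e (g e - g s) + (triple e e (g s) - triple s s (g s))"
      by (simp add: triple_diff_right)
    also have "norm \<dots> \<le> (norm e)\<^sup>2 * norm (g e - g s) + 2 * norm (e + s) * norm (e - s) * norm (g s)"
      by (rule norm_triangle_le[OF add_mono[OF norm_triple_le 1]])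
    finally show ?thesis .
  qed
  have "((\<lambda>e. (norm e)\<^sup>2 * norm (g e - g s) + 2 * norm (e + s) * norm (e - s) * norm (g s)) \<longlongrightarrow>
      (norm s)\<^sup>2 * norm (g s - g s) + 2 * norm (s + s) * norm (s - s) * norm (g s)) (at s)"
    by (intro tendsto_add tendsto_mult tendsto_power tendsto_norm tendsto_diff tendsto_const
        tendsto_ident_at gs)
  then have "((\<lambda>e. (norm e)\<^sup>2 * norm (g e - g s) + 2 * norm (e + s) * norm (e - s) * norm (g s)) \<longlongrightarrow> 0) (at s)"
    by simp
  then have "((\<lambda>e. triple e e (g e) - triple s s (g s)) \<longlongrightarrow> 0) (at s)"
    by (rule Lim_null_comparison[OF always_eventually[OF allI[OF bound]]])
  then show "((\<lambda>e. triple e e (g e)) \<longlongrightarrow> triple s s (g s)) (at s)"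
    by (rule LIM_zero_cancel)
qed

text \<open>Maximality as a system of equations in \<open>e\<close>: the projection onto \<open>Z\<^sub>0(e)\<close> vanishes.\<close>

lemma maximal_tripotent_iff:
  "maximal_tripotent e \<longleftrightarrow> triple e e e = e \<and> (\<forall>z. peirce_proj0 e z = 0)"
proof
  assume "maximal_tripotent e"
  then show "triple e e e = e \<and> (\<forall>z. peirce_proj0 e z = 0)"
    using peirce_proj_mem(3)[of e] by (auto simp: maximal_tripotent_def tripotent_def peirce_zero_iff)
next
  assume *: "triple e e e = e \<and> (\<forall>z. peirce_proj0 e z = 0)"
  have "z = 0" if "triple e e z = 0" for z
    using *[THEN conjunct2, rule_format, of z] that by (simp add: peirce_proj0_def)
  then show "maximal_tripotent e"
    using * by (simp add: maximal_tripotent_def tripotent_def)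
qed

lemma closed_maximal_tripotents: "closed {e. maximal_tripotent e}"
  unfolding maximal_tripotent_iff peirce_proj0_def
  by (intro closed_Collect_conj closed_Collect_all closed_Collect_eq continuous_intros continuous_on_box)

section \<open>Maximum principle on discs through maximal tripotents\<close>

lemma blaschke_factor_bounds:
  fixes m :: real and z :: complex
  assumes m: "0 \<le> m" "m < 1" and z: "cmod z \<le> 1"
  shows "1 + m * z \<noteq> 0" "cmod ((z + m) / (1 + m * z)) \<le> 1"
    "cmod z = 1 \<Longrightarrow> cmod ((z + m) / (1 + m * z)) = 1"
    "cmod z < 1 \<Longrightarrow> cmod ((z + m) / (1 + m * z)) < 1"
proof -
  have "cmod (m * z) = m * cmod z"
    using m by (simp add: norm_mult)
  also have "\<dots> \<le> m * 1"
    using m z by (intro mult_left_mono) auto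
  finally have small: "cmod (m * z) < 1"
    using m by simp
  show nz: "1 + m * z \<noteq> 0"
  proof
    assume "1 + m * z = 0"
    then have "m * z = - 1"
      by (simp add: eq_neg_iff_add_eq_0 add.commute)
    then show False
      using small by simp
  qed
  then have pos: "0 < cmod (1 + m * z)"
    by simp
  have id: "(cmod (1 + m * z))\<^sup>2 = (cmod (z + m))\<^sup>2 + (1 - (cmod z)\<^sup>2) * (1 - m\<^sup>2)"
    unfolding cmod_power2 by (simp add: power2_eq_square algebra_simps)
  have m2: "0 < 1 - m\<^sup>2"
    using m by (simp add: abs_square_less_1)
  have "(cmod (z + m))\<^sup>2 \<le> (cmod (1 + m * z))\<^sup>2"
    unfolding id using z m2 by (simp add: power_le_one)
  then have "cmod (z + m) \<le> cmod (1 + m * z)"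
    by (rule power2_le_imp_le) simp
  then show "cmod ((z + m) / (1 + m * z)) \<le> 1"
    unfolding norm_divide using pos by (simp only: divide_le_eq_1_pos)
  show "cmod ((z + m) / (1 + m * z)) = 1" if "cmod z = 1"
  proof -
    have "(cmod (1 + m * z))\<^sup>2 = (cmod (z + m))\<^sup>2"
      unfolding id that by simp
    then have "cmod (1 + m * z) = cmod (z + m)"
      by (rule power2_eq_imp_eq) simp_all
    then show ?thesis
      unfolding norm_divide using pos by (metis divide_self less_irrefl)
  qed
  show "cmod ((z + m) / (1 + m * z)) < 1" if "cmod z < 1"
  proof -
    have "0 < (1 - (cmod z)\<^sup>2) * (1 - m\<^sup>2)"
      using that m2 by (intro mult_pos_pos) (simp_all add: abs_square_less_1)
    then have "(cmod (z + m))\<^sup>2 < (cmod (1 + m * z))\<^sup>2"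
      unfolding id by linarith
    then have "cmod (z + m) < cmod (1 + m * z)"
      by (rule power_less_imp_less_base) simp
    then show ?thesis
      unfolding norm_divide using pos by (simp only: divide_less_eq_1_pos)
  qed
qed

lemma holomorphic_on_disc_combination:
  fixes f :: "'a \<Rightarrow> complex"
  assumes f: "cfrechet_holomorphic_on f (ball 0 1)"
    and b: "\<And>e. e \<in> E \<Longrightarrow> b e holomorphic_on ball 0 1"
    and maps: "\<And>z. cmod z < 1 \<Longrightarrow> norm (\<Sum>e\<in>E. b e z *\<^sub>C e) < 1"
  shows "(\<lambda>z. f (\<Sum>e\<in>E. b e z *\<^sub>C e)) holomorphic_on ball 0 1"
proof (rule holomorphic_onI)
  fix z :: complex assume z: "z \<in> ball 0 1"
  let ?g = "\<lambda>z. \<Sum>e\<in>E. b e z *\<^sub>C e"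
  define d where "d e = deriv (b e) z" for e
  have "(b e has_derivative (\<lambda>h. d e * h)) (at z)" if "e \<in> E" for e
    using holomorphic_derivI[OF b[OF that] _ z] by (simp add: has_field_derivative_def d_def)
  then have g: "(?g has_derivative (\<lambda>h. \<Sum>e\<in>E. (d e * h) *\<^sub>C e)) (at z)"
    by (intro has_derivative_sum bounded_linear.has_derivative[OF bounded_linear_scaleC_left])
  have "?g z \<in> ball 0 1"
    using maps[of z] z by simp
  then obtain D where D: "(f has_derivative D) (at (?g z))" "Vector_Spaces.linear scaleC (*) D"
    using f unfolding cfrechet_holomorphic_on_def by blast
  have "D (\<Sum>e\<in>E. (d e * h) *\<^sub>C e) = D (\<Sum>e\<in>E. d e *\<^sub>C e) * h" for h
  proof -
    have "(\<Sum>e\<in>E. (d e * h) *\<^sub>C e) = h *\<^sub>C (\<Sum>e\<in>E. d e *\<^sub>C e)"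
      by (simp add: complex_vector.scale_sum_right scaleC_scaleC mult.commute)
    then show ?thesis
      using D(2) by (simp add: complex_functional_iff mult.commute)
  qed
  then have "((\<lambda>z. f (?g z)) has_field_derivative D (\<Sum>e\<in>E. d e *\<^sub>C e)) (at z)"
    using has_derivative_compose[OF g D(1)] by (simp add: has_field_derivative_def)
  then show "(\<lambda>z. f (?g z)) field_differentiable at z within ball 0 1"
    using field_differentiable_at_within field_differentiable_def by blast
qed

text \<open>Write \<open>z = \<Sum> m\<^sub>e e\<close> with the sum of the tripotents maximal, and pass through \<open>z\<close> a disc whose
  coordinates are Blaschke factors taking the value \<open>m\<^sub>e\<close> at the origin: its boundary runs in the
  torus of unimodular combinations, all of which are maximal tripotents.\<close>

lemma maximal_tripotent_dominates:
  assumes rank: "rank_le triple r" and f: "f \<in> ball_algebra" and z: "norm z < 1"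
  shows "\<exists>u. maximal_tripotent u \<and> cmod (f z) \<le> cmod (f u)"
proof -
  have hol: "cfrechet_holomorphic_on f (ball 0 1)" and cont: "continuous_on (cball 0 1) f"
    using f by (simp_all add: ball_algebra_def)
  obtain E0 l where E0: "orthogonal_tripotents E0" "\<forall>f\<in>E0. 0 < l f" "inj_on l E0" "z = (\<Sum>f\<in>E0. l f *\<^sub>R f)"
    using spectral_decomposition[OF rank] by blast
  obtain E where E: "E0 \<subseteq> E" "orthogonal_tripotents E" "maximal_tripotent (\<Sum>E)"
    using extend_to_maximal_tripotent[OF rank E0(1)] by blast
  note fin = orthogonal_tripotentsD(1)[OF E(2)]
  define m where "m e = (if e \<in> E0 then l e else 0)" for e
  have m: "0 \<le> m e" "m e < 1" for e
  proof -
    have "l e < 1" if "e \<in> E0"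
    proof -
      have "cmod (complex_of_real (l e)) \<le> norm z"
        unfolding E0(4) real_combination by (rule coefficient_le_norm[OF E0(1) that])
      then show ?thesis
        using z by simp
    qed
    then show "0 \<le> m e" "m e < 1"
      using E0(2) by (auto simp: m_def less_imp_le)
  qed
  define b where "b e \<zeta> = (\<zeta> + complex_of_real (m e)) / (1 + complex_of_real (m e) * \<zeta>)" for e \<zeta>
  note b = blaschke_factor_bounds[OF m, folded b_def]
  define g where "g \<zeta> = (\<Sum>e\<in>E. b e \<zeta> *\<^sub>C e)" for \<zeta>
  have "z = (\<Sum>e\<in>E. m e *\<^sub>R e)"
    unfolding E0(4) using E(1) fin by (intro sum.mono_neutral_cong_left) (auto simp: m_def)
  then have g0: "g 0 = z"
    by (simp add: g_def b_def scaleR_scaleC)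
  have ball: "norm (g \<zeta>) < 1" if "cmod \<zeta> < 1" for \<zeta>
  proof -
    \<comment> \<open>The entry \<open>1/2\<close> keeps \<open>R\<close> positive.\<close>
    define R where "R = Max (insert (1/2) ((\<lambda>e. cmod (b e \<zeta>)) ` E))"
    have "R < 1"
      using fin b(4) that by (simp add: R_def)
    moreover have "1/2 \<le> R"
      unfolding R_def using fin by (intro Max_ge) auto
    moreover have "norm (g \<zeta>) \<le> R"
      unfolding g_def using \<open>1/2 \<le> R\<close> fin by (intro norm_combination_le[OF E(2)]) (auto simp: R_def)
    ultimately show ?thesis
      by simp
  qed
  have cball: "norm (g \<zeta>) \<le> 1" if "cmod \<zeta> \<le> 1" for \<zeta>
    unfolding g_def using b(2) that by (intro norm_combination_le_1[OF E(2)]) auto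
  have "b e holomorphic_on ball 0 1" for e
    unfolding b_def using b(1) by (intro holomorphic_intros) auto
  then have holo: "(\<lambda>\<zeta>. f (g \<zeta>)) holomorphic_on ball 0 1"
    unfolding g_def using ball by (intro holomorphic_on_disc_combination[OF hol]) (auto simp: g_def)
  have "continuous_on (cball 0 1) (b e)" for e
    unfolding b_def using b(1) by (intro continuous_intros) auto
  then have "continuous_on (cball 0 1) g"
    unfolding g_def
    by (intro continuous_on_sum bounded_linear.continuous_on[OF bounded_linear_scaleC_left])
  then have contfg: "continuous_on (cball 0 1) (\<lambda>\<zeta>. f (g \<zeta>))"
    using cball by (intro continuous_on_compose2[OF cont]) auto
  then have "continuous_on (sphere 0 1) (\<lambda>\<zeta>. cmod (f (g \<zeta>)))"
    by (intro continuous_on_norm) (rule continuous_on_subset, auto)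
  moreover have "sphere 0 1 \<noteq> ({} :: complex set)"
    by (auto intro!: exI[of _ 1])
  ultimately obtain \<zeta>0 where \<zeta>0: "\<zeta>0 \<in> sphere 0 1" "\<And>\<zeta>. \<zeta> \<in> sphere 0 1 \<Longrightarrow> cmod (f (g \<zeta>)) \<le> cmod (f (g \<zeta>0))"
    using continuous_attains_sup[of "sphere 0 1" "\<lambda>\<zeta>. cmod (f (g \<zeta>))"] by auto
  have "cmod (f (g 0)) \<le> cmod (f (g \<zeta>0))"
    by (rule maximum_modulus_frontier[of "\<lambda>\<zeta>. f (g \<zeta>)" "ball 0 1"])
      (use holo contfg \<zeta>0(2) in \<open>auto simp: frontier_def\<close>)
  moreover have "maximal_tripotent (g \<zeta>0)"
  proof -
    have "cmod (b e \<zeta>0) = 1" for e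
      using \<zeta>0(1) b(3) by simp
    then show ?thesis
      using tripotent_unimodular_combination[OF E(2), of "\<lambda>e. b e \<zeta>0"]
        box_unimodular_combination[OF E(2), of "\<lambda>e. b e \<zeta>0"] E(3)
      by (simp add: maximal_tripotent_def g_def)
  qed
  ultimately show ?thesis
    using g0 by auto
qed

lemma maximal_tripotents_sup_determining:
  assumes rank: "rank_le triple r"
  shows "sup_determining {e. maximal_tripotent e}"
  unfolding sup_determining_def
proof
  fix f :: "'a \<Rightarrow> complex" assume f: "f \<in> ball_algebra"
  let ?B = "SUP z\<in>{e. maximal_tripotent e}. ennreal (cmod (f z))"
  have "continuous_on (closure (ball 0 1)) (\<lambda>z. cmod (f z))"
    using f by (intro continuous_on_norm) (simp add: ball_algebra_def)
  have le: "ennreal (cmod (f z)) \<le> ?B" if "z \<in> closure (ball 0 1)" for z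
  proof (cases ?B)
    case (real B)
    have "cmod (f w) \<le> B" if w: "w \<in> ball 0 1" for w
    proof -
      obtain u where "maximal_tripotent u" "cmod (f w) \<le> cmod (f u)"
        using maximal_tripotent_dominates[OF rank f, of w] w by auto
      then have "ennreal (cmod (f w)) \<le> ?B"
        by (intro SUP_upper2[of u]) (auto simp: ennreal_leI)
      then show ?thesis
        using real by simp
    qed
    then have "cmod (f z) \<le> B"
      using continuous_le_on_closure[OF \<open>continuous_on _ (\<lambda>z. cmod (f z))\<close> that] by blast
    then show ?thesis
      using real by (simp add: ennreal_leI)
  next
    case top
    show ?thesis
      unfolding top by (rule top_greatest)
  qed
  have "{e. maximal_tripotent e} \<subseteq> closure (ball 0 1)"
    using norm_tripotent_le_1 by (auto simp: maximal_tripotent_def)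
  then show "(SUP z\<in>closure (ball 0 1). ennreal (cmod (f z))) = ?B"
    using le by (intro antisym SUP_least SUP_subset_mono) auto
qed

section \<open>Minimality\<close>

text \<open>\<open>exp\<close> of the exposing functional of \<open>e\<close> lies in the ball algebra, and away from \<open>e\<close> its
  modulus stays uniformly below the value at \<open>e\<close>.\<close>

lemma maximal_tripotent_in_determining_set:
  assumes rank: "rank_le triple r" and max: "maximal_tripotent e"
    and L: "closed L" "L \<subseteq> closure (ball 0 1)" "sup_determining L"
  shows "e \<in> L"
proof (rule ccontr)
  assume "e \<notin> L"
  then obtain \<delta> where \<delta>: "0 < \<delta>" "ball e \<delta> \<subseteq> - L"
    using L(1) by (metis closed_def open_contains_ball Compl_iff)
  then have far: "\<delta> \<le> norm (z - e)" if "z \<in> L" for z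
    using that by (force simp: dist_norm norm_minus_commute)
  obtain \<phi> :: "'a \<Rightarrow> complex" and n :: nat where \<phi>: "Vector_Spaces.linear scaleC (*) \<phi>" "bounded_linear \<phi>" "\<phi> e = of_nat n"
    and peak: "\<And>z. norm z \<le> 1 \<Longrightarrow> Re (\<phi> z) \<le> n \<and> norm (z - e) \<le> 15 * n * sqrt (n - Re (\<phi> z))"
    using maximal_tripotent_strongly_exposed[OF rank max] by blast
  define f where "f z = exp (\<phi> z)" for z
  have "(f has_derivative (\<lambda>h. exp (\<phi> x) * \<phi> h)) (at x)" for x
  proof -
    have "(exp has_derivative (\<lambda>h. exp (\<phi> x) * h)) (at (\<phi> x))"
      using DERIV_exp[of "\<phi> x"] by (simp add: has_field_derivative_def)
    then show ?thesis
      unfolding f_def using has_derivative_compose[OF bounded_linear_imp_has_derivative[OF \<phi>(2)]] by blast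
  qed
  moreover have "Vector_Spaces.linear scaleC (*) (\<lambda>h. exp (\<phi> x) * \<phi> h)" for x
    using \<phi>(1) by (simp add: complex_functional_iff algebra_simps)
  ultimately have "cfrechet_holomorphic_on f (ball 0 1)"
    unfolding cfrechet_holomorphic_on_def by blast
  moreover have "continuous_on (closure (ball 0 1)) f"
    unfolding f_def by (intro continuous_on_exp linear_continuous_on \<phi>(2))
  ultimately have "f \<in> ball_algebra"
    by (simp add: ball_algebra_def)
  then have sup: "(SUP z\<in>closure (ball 0 1). ennreal (cmod (f z))) = (SUP z\<in>L. ennreal (cmod (f z)))"
    using L(3) by (simp add: sup_determining_def)
  \<comment> \<open>The denominator contains \<open>n + 1\<close> instead of \<open>n\<close>, which may be \<open>0\<close>.\<close>
  define \<eta> where "\<eta> = (\<delta> / (15 * (n + 1)))\<^sup>2"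
  have \<eta>: "0 < \<eta>"
    using \<delta>(1) by (simp add: \<eta>_def)
  have "cmod (f z) \<le> exp (n - \<eta>)" if z: "z \<in> L" for z
  proof -
    have "norm z \<le> 1"
      using z L(2) by auto
    then have *: "Re (\<phi> z) \<le> n" "\<delta> \<le> 15 * n * sqrt (n - Re (\<phi> z))"
      using peak far[OF z] by (blast, force)
    have "15 * n * sqrt (n - Re (\<phi> z)) \<le> 15 * (n + 1) * sqrt (n - Re (\<phi> z))"
      using *(1) by (intro mult_right_mono) auto
    then have "\<delta> \<le> 15 * (n + 1) * sqrt (n - Re (\<phi> z))"
      using *(2) by linarith
    then have "\<delta> / (15 * (n + 1)) \<le> sqrt (n - Re (\<phi> z))"
      by (simp add: divide_le_eq mult.commute)
    then have "\<eta> \<le> (sqrt (n - Re (\<phi> z)))\<^sup>2"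
      unfolding \<eta>_def using \<delta>(1) by (intro power_mono) auto
    then have "\<eta> \<le> n - Re (\<phi> z)"
      using *(1) by simp
    then show ?thesis
      by (simp add: f_def norm_exp_eq_Re)
  qed
  then have "(SUP z\<in>L. ennreal (cmod (f z))) \<le> ennreal (exp (n - \<eta>))"
    by (intro SUP_least ennreal_leI)
  moreover have "ennreal (exp n) \<le> (SUP z\<in>closure (ball 0 1). ennreal (cmod (f z)))"
  proof (rule SUP_upper2[of e])
    show "e \<in> closure (ball 0 1)"
      using max norm_tripotent_le_1 by (simp add: maximal_tripotent_def)
    show "ennreal (exp n) \<le> ennreal (cmod (f e))"
      by (simp add: f_def norm_exp_eq_Re \<phi>(3))
  qed
  ultimately have "ennreal (exp n) \<le> ennreal (exp (n - \<eta>))"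
    unfolding sup by (rule order_trans[rotated])
  then show False
    using \<eta> by simp
qed

end

theorem theorem5p10:
  fixes triple :: "'a::complex_banach \<Rightarrow> 'a \<Rightarrow> 'a \<Rightarrow> 'a"
    and r :: nat
    and \<Gamma> :: "'a set"
  assumes "jb_star_triple triple"
    and "has_rank triple r"
    and "\<Gamma> = {e. e extreme_point_of closure (ball 0 1)}"
  shows "closed \<Gamma> \<and> \<Gamma> \<subseteq> closure (ball 0 1) \<and> sup_determining \<Gamma> \<and>
    (\<forall>\<Lambda>. closed \<Lambda> \<and> \<Lambda> \<subseteq> closure (ball 0 1) \<and> sup_determining \<Lambda> \<longrightarrow> \<Gamma> \<subseteq> \<Lambda>)"
proof -
  interpret jb_star_triple triple
    by (rule assms(1))
  have rank: "rank_le triple r"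
    using assms(2) by (simp add: has_rank_def)
  have \<Gamma>: "\<Gamma> = {e. maximal_tripotent e}"
    using assms(3) extreme_points_eq_maximal_tripotents[OF rank] by simp
  have "\<Gamma> \<subseteq> closure (ball 0 1)"
    unfolding assms(3) by (auto simp: extreme_point_of_def)
  then show ?thesis
    using closed_maximal_tripotents maximal_tripotents_sup_determining[OF rank]
      maximal_tripotent_in_determining_set[OF rank] unfolding \<Gamma> by blast
qed

end
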